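(* Let $q>1$ be a real number. (i) If $q\in\overline{\mathcal U}$, then $q$ is neither stable from below nor stable from above. (ii) If $q\in\mathcal V\setminus\overline{\mathcal U}$, then $q$ is stable from below, but not stable from above. (iii) If $q\notin\mathcal V$, then $q$ is stable.
   Context: Let $\mathbb N=\{1,2,\dots\}$. A sequence is an element of $\{0,1,2,\dots\}^{\mathbb N}$; it is called infinite if it has infinitely many nonzero terms. Sequences are compared lexicographically. For a real $q>1$, let $\lceil q\rceil$ be the smallest integer $\ge q$. An expansion of a real number $x$ in base $q$ is a sequence $(c_i)$ of integers with $0\le c_i<q$ for all $i\ge1$ and $x=\sum_{i\ge1}c_iq^{-i}$. Write $(\alpha_i)=(\alpha_i(q))$ for the quasi-greedy expansion of $1$ in base $q$, i.e. the lexicographically largest infinite expansion of $1$ in base $q$ (it exists); one has $\alpha_1=\lceil q\rceil-1$. For a digit $c\in\{0,\dots,\alpha_1\}$ put $\overline c=\alpha_1-c$, and $\overline{c_1c_2\ldots}=\overline{c_1}\,\overline{c_2}\ldots$. $\mathcal U$ is the set of real numbers $q>1$ for which $1$ has exactly one expansion in base $q$, and $\overline{\mathcal U}$ is its topological closure. $\mathcal V$ is the set of real numbers $q>1$ for which $\overline{\alpha_{k+1}(q)\alpha_{k+2}(q)\ldots}\le\alpha_1(q)\alpha_2(q)\ldots$ for all $k\ge1$. One has $\mathcal U\subset\overline{\mathcal U}\subset\mathcal V$. For $q>1$, $\mathcal U_q$ is the set of real numbers $x$ having exactly one expansion in base $q$, and $\mathcal U_q'$ is the set of these unique expansions of the elements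 $x\in\mathcal U_q$. A number $q>1$ is stable from above if there exists $s>q$ with $\mathcal U_q'=\mathcal U_s'$; it is stable from below if there exists $s$ with $1<s<q$ and $\mathcal U_q'=\mathcal U_s'$; it is stable if it is stable from above and from below. (If $1<q<r$ and $\mathcal U_q'=\mathcal U_r'$, then $\mathcal U_q'=\mathcal U_t'$ for each $t\in(q,r)$.) *)

theory Defs
  imports "HOL-Analysis.Analysis" "HOL-Library.Fun_Lexorder"
begin

text \<open>Sequences \<open>(c\<^sub>i)\<close> with \<open>i \<ge> 1\<close> are functions on \<open>nat\<close> with the index shifted by one:
  \<open>c i\<close> stands for \<open>c\<^sub>i\<^sub>+\<^sub>1\<close>. The library's \<open>less_fun\<close> is the strict lexicographic order.\<close>

definition lex_le :: "(nat \<Rightarrow> nat) \<Rightarrow> (nat \<Rightarrow> nat) \<Rightarrow> bool" where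
  "lex_le c d \<longleftrightarrow> less_fun c d \<or> c = d"

definition infinite_seq :: "(nat \<Rightarrow> nat) \<Rightarrow> bool" where
  "infinite_seq c \<longleftrightarrow> infinite {i. c i \<noteq> 0}"

definition expansion :: "real \<Rightarrow> real \<Rightarrow> (nat \<Rightarrow> nat) \<Rightarrow> bool" where
  "expansion q x c \<longleftrightarrow> (\<forall>i. real (c i) < q) \<and> (\<lambda>i. real (c i) / q ^ Suc i) sums x"

text \<open>The description is only meaningful for \<open>q > 1\<close>, where such a sequence exists;
  uniqueness is immediate since the lexicographic order is antisymmetric.\<close>

definition quasi_greedy :: "real \<Rightarrow> nat \<Rightarrow> nat" where
  "quasi_greedy q = (THE c. expansion q 1 c \<and> infinite_seq c \<and>
     (\<forall>d. expansion q 1 d \<and> infinite_seq d \<longrightarrow> lex_le d c))"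

text \<open>Reflection of digits, \<open>c \<mapsto> \<alpha>\<^sub>1 - c\<close>. The subtraction on \<open>nat\<close> does not truncate on
  digits in \<open>{0..\<alpha>\<^sub>1}\<close>, i.e. on all nonnegative integers below \<open>q\<close>, as \<open>\<alpha>\<^sub>1 = \<lceil>q\<rceil> - 1\<close>.\<close>

definition reflect :: "real \<Rightarrow> (nat \<Rightarrow> nat) \<Rightarrow> nat \<Rightarrow> nat" where
  "reflect q c = (\<lambda>i. quasi_greedy q 0 - c i)"

definition univoque_bases :: "real set" ("\<U>") where
  "\<U> = {q. q > 1 \<and> (\<exists>!c. expansion q 1 c)}"

definition V_bases :: "real set" ("\<V>") where
  "\<V> = {q. q > 1 \<and>
     (\<forall>k\<ge>1. lex_le (reflect q (\<lambda>i. quasi_greedy q (k + i))) (quasi_greedy q))}"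

definition univoque_set :: "real \<Rightarrow> real set" where
  "univoque_set q = {x. \<exists>!c. expansion q x c}"

definition univoque_seqs :: "real \<Rightarrow> (nat \<Rightarrow> nat) set" where
  "univoque_seqs q = {c. \<exists>x\<in>univoque_set q. expansion q x c}"

definition stable_above :: "real \<Rightarrow> bool" where
  "stable_above q \<longleftrightarrow> (\<exists>s>q. univoque_seqs q = univoque_seqs s)"

definition stable_below :: "real \<Rightarrow> bool" where
  "stable_below q \<longleftrightarrow> (\<exists>s. 1 < s \<and> s < q \<and> univoque_seqs q = univoque_seqs s)"

definition stable_base :: "real \<Rightarrow> bool" where
  "stable_base q \<longleftrightarrow> stable_above q \<and> stable_below q"

end

theory Submission
  imports Defs
begin

text \<open>
  Write \<open>a = a(q)\<close> for the quasi-greedy expansion of 1 in base \<open>q\<close>, \<open>A\<close> for its first digit and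
  \<open>mirror\<close> for the reflection \<open>d \<mapsto> A - d\<close>. Everything is reduced to lexicographic statements
  about \<open>a\<close>. A sequence \<open>c\<close> is a unique expansion in base \<open>q\<close> if and only if it is admissible:
  its tail after a digit less than \<open>A\<close> is smaller than \<open>a\<close>, and its reflected tail after a positive
  digit is smaller than \<open>a\<close> (\<open>univoque_seqs_eq_admissible\<close>). Since \<open>a(q)\<close> increases strictly
  with \<open>q\<close>, stability asks whether admissibility can change when \<open>a\<close> is replaced by a nearby \<open>a(s)\<close>.

  The decisive set is that of the strict bases, those with \<open>mirror (tail k a) < a\<close> for all
  \<open>k \<ge> 1\<close>; for \<open>\<V>\<close> the same inequalities are required with \<open>\<le>\<close>.

  Stability (\<open>univoque_seqs_eqI\<close>): let \<open>mirror (tail k (a(s))) \<ge> a(s)\<close> with \<open>k \<ge> 1\<close>, and let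
  \<open>t < s\<close> be such that \<open>a(t)\<close> and \<open>a(s)\<close> agree in the first \<open>k\<close> digits. An admissible sequence for
  \<open>s\<close> with a tail in the interval from \<open>a(t)\<close> to \<open>a(s)\<close> would, \<open>k\<close> places later, have a reflected
  tail above \<open>a(s)\<close>; so \<open>t\<close> and \<open>s\<close> have the same unique expansions. As \<open>a\<close> is continuous from the
  left, a base that is not strict is stable from below. If \<open>q \<notin> \<V>\<close>, the right limit of \<open>a\<close> at
  \<open>q\<close>, which is the greedy expansion of 1, still violates the inequality for some \<open>k\<close> such that
  its first \<open>k\<close> digits agree with those of \<open>a(q)\<close>, and \<open>q\<close> is stable from above.

  Instability (\<open>univoque_seqs_neqI\<close>): if \<open>s \<le> t < q\<close> and \<open>t \<in> \<V>\<close>, then \<open>s\<close> and \<open>q\<close> have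
  different unique expansions. Hence no base of \<open>\<V>\<close> is stable from above, and a base that is a
  limit of bases of \<open>\<V>\<close> from below is not stable from below. Every strict base is such a limit
  (\<open>strict_base_limit_of_V\<close>).

  It remains to see that the strict bases are the elements of \<open>closure \<U>\<close> above 1
  (\<open>closure_univoque_bases_iff\<close>). A base that is not strict has a punctured
  neighbourhood without elements of \<open>\<V>\<close>: on the left because an element of \<open>\<V>\<close> would change the
  unique expansions, on the right because the right limit of \<open>a\<close> violates the inequalities
  defining \<open>\<V>\<close>. Conversely, a strict base outside \<open>\<U>\<close> has a
  periodic \<open>a\<close>, and one period of \<open>a\<close> followed by \<open>a(t)\<close>, for \<open>t \<in> \<V>\<close> slightly below \<open>q\<close>, is
  the quasi-greedy expansion in a base of \<open>\<U>\<close> between \<open>t\<close> and \<open>q\<close>.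
\<close>

section \<open>The lexicographic order, tails and reflections\<close>

abbreviation lex_less :: "(nat \<Rightarrow> nat) \<Rightarrow> (nat \<Rightarrow> nat) \<Rightarrow> bool" (infix "\<sqsubset>" 50) where
  "c \<sqsubset> d \<equiv> less_fun c d"

abbreviation lex_less_eq :: "(nat \<Rightarrow> nat) \<Rightarrow> (nat \<Rightarrow> nat) \<Rightarrow> bool" (infix "\<sqsubseteq>" 50) where
  "c \<sqsubseteq> d \<equiv> lex_le c d"

text \<open>The sequence without its first \<open>n\<close> terms.\<close>

definition tail :: "nat \<Rightarrow> (nat \<Rightarrow> nat) \<Rightarrow> nat \<Rightarrow> nat" where
  "tail n c = (\<lambda>i. c (n + i))"

text \<open>Reflection with respect to an explicit largest digit \<open>A\<close>; \<open>reflect q\<close> is the case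
  \<open>A = quasi_greedy q 0\<close>.\<close>

definition mirror :: "nat \<Rightarrow> (nat \<Rightarrow> nat) \<Rightarrow> nat \<Rightarrow> nat" where
  "mirror A c = (\<lambda>i. A - c i)"

text \<open>\<open>agree n c d\<close>: the first \<open>n\<close> terms of \<open>c\<close> and \<open>d\<close> coincide.\<close>

definition agree :: "nat \<Rightarrow> (nat \<Rightarrow> nat) \<Rightarrow> (nat \<Rightarrow> nat) \<Rightarrow> bool" where
  "agree n c d \<longleftrightarrow> (\<forall>i<n. c i = d i)"

lemma lex_linorder: "class.linorder lex_le (less_fun :: (nat \<Rightarrow> nat) \<Rightarrow> _)"
proof -
  have total: "c \<sqsubset> d \<or> c = d \<or> d \<sqsubset> c" for c d :: "nat \<Rightarrow> nat"
  proof (cases "c = d")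
    case False
    then have ex: "\<exists>i. c i \<noteq> d i" by auto
    define n where "n = (LEAST i. c i \<noteq> d i)"
    have "c n \<noteq> d n" unfolding n_def using ex by (rule LeastI_ex)
    moreover have "\<forall>i<n. c i = d i" unfolding n_def using not_less_Least by blast
    ultimately show ?thesis unfolding less_fun_def by (metis linorder_neqE_nat)
  qed simp
  show ?thesis
    by unfold_locales
      (auto simp: lex_le_def less_fun_irrefl dest: less_fun_asym less_fun_trans,
       use total in blast)
qed

interpretation lex: linorder lex_le "less_fun :: (nat \<Rightarrow> nat) \<Rightarrow> _"
  by (rule lex_linorder)

lemma tail_apply: "tail n c i = c (n + i)"
  by (simp add: tail_def)

lemma tail_tail [simp]: "tail m (tail n c) = tail (n + m) c"
  by (simp add: tail_def add.assoc)

lemma tail_0 [simp]: "tail 0 c = c"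
  by (simp add: tail_def)

lemma mirror_apply [simp]: "mirror A c i = A - c i"
  by (simp add: mirror_def)

lemma tail_mirror: "tail n (mirror A c) = mirror A (tail n c)"
  by (simp add: tail_def mirror_def)

lemma mirror_mirror: "(\<And>i. c i \<le> A) \<Longrightarrow> mirror A (mirror A c) = c"
  by (rule ext) simp

lemma mirror_antimono_iff:
  assumes "\<And>i. c i \<le> A" "\<And>i. d i \<le> A"
  shows "mirror A c \<sqsubset> mirror A d \<longleftrightarrow> d \<sqsubset> c"
proof -
  have "A - c i < A - d i \<longleftrightarrow> d i < c i" "A - c i = A - d i \<longleftrightarrow> d i = c i" for i
    using assms[of i] by auto
  then show ?thesis by (simp add: less_fun_def)
qed

lemma agree_trans: "agree n c d \<Longrightarrow> agree n d e \<Longrightarrow> agree n c e"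
  by (simp add: agree_def)

lemma agree_sym: "agree n c d \<Longrightarrow> agree n d c"
  by (simp add: agree_def)

lemma agree_mono: "agree n c d \<Longrightarrow> m \<le> n \<Longrightarrow> agree m c d"
  by (simp add: agree_def)

lemma agree_tail: "agree (k + n) c d \<Longrightarrow> agree n (tail k c) (tail k d)"
  by (simp add: agree_def tail_apply)

lemma agree_mirror: "agree n c d \<Longrightarrow> agree n (mirror A c) (mirror A d)"
  by (simp add: agree_def)

lemma lex_lessI: "c n < d n \<Longrightarrow> agree n c d \<Longrightarrow> c \<sqsubset> d"
  by (auto simp: less_fun_def agree_def)

lemma lex_lessE:
  assumes "c \<sqsubset> d"
  obtains n where "c n < d n" "agree n c d"
  using assms by (auto simp: less_fun_def agree_def)

lemma lex_le_head: "c \<sqsubseteq> d \<Longrightarrow> c 0 \<le> d 0"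
  unfolding lex_le_def less_fun_def by (metis gr0I less_imp_le order_refl)

lemma lex_tail_iff:
  assumes "agree n c d"
  shows "c \<sqsubset> d \<longleftrightarrow> tail n c \<sqsubset> tail n d"
proof
  assume "c \<sqsubset> d"
  then obtain m where m: "c m < d m" "agree m c d" by (rule lex_lessE)
  have "n \<le> m" using m(1) assms by (metis agree_def leI less_irrefl)
  then show "tail n c \<sqsubset> tail n d"
    using m agree_tail[of n "m - n" c d] by (intro lex_lessI[of _ "m - n"]) (auto simp: tail_apply)
next
  assume "tail n c \<sqsubset> tail n d"
  then obtain m where m: "tail n c m < tail n d m" "agree m (tail n c) (tail n d)"
    by (rule lex_lessE)
  have "c i = d i" if "i < n + m" for i
    using assms m(2) that unfolding agree_def tail_apply
    by (metis add_diff_inverse_nat nat_add_left_cancel_less)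
  then show "c \<sqsubset> d" using m(1) by (intro lex_lessI[of _ "n + m"]) (auto simp: agree_def tail_apply)
qed

lemma agree_tail_eq:
  assumes "agree n c d" "tail n c = tail n d"
  shows "c = d"
proof
  fix i
  have "c (n + j) = d (n + j)" for j
    using fun_cong[OF assms(2), of j] by (simp add: tail_apply)
  from this[of "i - n"] show "c i = d i"
    using assms(1) by (cases "i < n") (auto simp: agree_def)
qed

lemma lex_le_tail_iff:
  "agree n c d \<Longrightarrow> c \<sqsubseteq> d \<longleftrightarrow> tail n c \<sqsubseteq> tail n d"
  unfolding lex_le_def using lex_tail_iff agree_tail_eq by blast

lemma lex_less_agree:
  assumes "c n < d n" "agree n c d" "agree (Suc n) c c'" "agree (Suc n) d d'"
  shows "c' \<sqsubset> d'"
  using assms by (intro lex_lessI[of _ n]) (auto simp: agree_def)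

lemma lex_between_agree:
  assumes "agree n c d" "c \<sqsubseteq> x" "x \<sqsubseteq> d"
  shows "agree n c x"
proof (rule ccontr)
  assume "\<not> agree n c x"
  then have ex: "\<exists>i. i < n \<and> c i \<noteq> x i" by (auto simp: agree_def)
  define m where "m = (LEAST i. i < n \<and> c i \<noteq> x i)"
  have m: "m < n" "c m \<noteq> x m" using LeastI_ex[OF ex] by (auto simp: m_def)
  have ag: "agree m c x"
    unfolding agree_def using not_less_Least[of _ "\<lambda>i. i < n \<and> c i \<noteq> x i"] m(1)
    by (auto simp: m_def[symmetric])
  then have "agree m x d" using assms(1) m by (auto simp: agree_def)
  then have "tail m c \<sqsubseteq> tail m x" "tail m x \<sqsubseteq> tail m d"
    using ag assms(2,3) lex_le_tail_iff by blast+
  from this[THEN lex_le_head] show False using m assms(1) by (simp add: agree_def tail_apply)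
qed

section \<open>Admissible sequences\<close>

text \<open>The lexicographic condition that characterizes the unique expansions in base \<open>q\<close>
  when \<open>a\<close> is the quasi-greedy expansion of 1 and \<open>A\<close> its first digit.\<close>

definition admissible :: "nat \<Rightarrow> (nat \<Rightarrow> nat) \<Rightarrow> (nat \<Rightarrow> nat) \<Rightarrow> bool" where
  "admissible A a c \<longleftrightarrow> (\<forall>i. c i \<le> A) \<and>
     (\<forall>n. c n < A \<longrightarrow> tail (Suc n) c \<sqsubset> a) \<and>
     (\<forall>n. 0 < c n \<longrightarrow> mirror A (tail (Suc n) c) \<sqsubset> a)"

lemma admissible_mirror:
  assumes "admissible A a c"
  shows "admissible A a (mirror A c)"
proof -
  have "mirror A (mirror A (tail n c)) = tail n c" for n
    using assms by (intro mirror_mirror) (simp add: admissible_def tail_apply)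
  then show ?thesis using assms by (auto simp: admissible_def tail_mirror)
qed

lemma admissible_mono:
  "admissible A a c \<Longrightarrow> a \<sqsubset> b \<Longrightarrow> admissible A b c"
  unfolding admissible_def by (blast intro: less_fun_trans)

text \<open>Not only the tail after a digit less than \<open>A\<close>, but every later tail is below \<open>a\<close>: after the largest digit \<open>A\<close> the
  bound is inherited because \<open>tail 1 a \<sqsubseteq> a\<close>.\<close>

lemma admissible_tail_less:
  assumes adm: "admissible A a c" and a: "a 0 = A" "tail 1 a \<sqsubseteq> a"
    and "c n < A" "n < m"
  shows "tail m c \<sqsubset> a"
proof -
  have "tail (Suc n + k) c \<sqsubset> a" for k
  proof (induction k)
    case 0
    have "tail (Suc n) c \<sqsubset> a" using adm assms(4) unfolding admissible_def by blast
    then show ?case by simp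
  next
    case (Suc k)
    let ?m = "Suc n + k"
    show ?case
    proof (cases "c ?m < A")
      case True
      then show ?thesis using adm by (simp add: admissible_def)
    next
      case False
      then have "c ?m = A" using adm by (simp add: admissible_def le_antisym)
      then have "agree 1 (tail ?m c) a" using a(1) by (simp add: agree_def tail_apply)
      then have "tail 1 (tail ?m c) \<sqsubset> tail 1 a" using Suc lex_tail_iff by blast
      then show ?thesis using lex.less_le_trans[OF _ a(2)] by simp
    qed
  qed
  from this[of "m - Suc n"] show ?thesis using assms(5) by simp
qed

lemma admissible_tail_mirror_less:
  assumes "admissible A a c" and "a 0 = A" "tail 1 a \<sqsubseteq> a"
    and "0 < c n" "n < m"
  shows "mirror A (tail m c) \<sqsubset> a"
  using admissible_tail_less[OF admissible_mirror[OF assms(1)] assms(2,3), of n m] assms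
  by (simp add: tail_mirror admissible_def) (metis diff_less le_zero_eq neq0_conv)

text \<open>The mechanism behind stability. A tail \<open>x\<close> of \<open>c\<close> with \<open>b \<sqsubseteq> x \<sqsubset> a\<close> starts with the
  common prefix of \<open>a\<close> and \<open>b\<close>, so its remainder is below that of \<open>a\<close>; reflected, it is above
  \<open>mirror A (tail k a)\<close>, hence above \<open>a\<close>, which admissibility forbids.\<close>

lemma admissible_shrink:
  assumes adm: "admissible A a c" and a: "\<And>i. a i \<le> A" "a 0 = A" "tail 1 a \<sqsubseteq> a" "0 < A"
    and b: "b \<sqsubset> a" "agree k b a" "1 \<le> k" and bad: "a \<sqsubseteq> mirror A (tail k a)"
  shows "admissible A b c"
proof -
  have main: "tail (Suc n) c \<sqsubset> b" if adm: "admissible A a c" and n: "c n < A" for c n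
  proof (rule ccontr)
    define x where "x = tail (Suc n) c"
    assume "\<not> tail (Suc n) c \<sqsubset> b"
    then have "b \<sqsubseteq> x" by (simp add: x_def lex.not_less)
    have "x \<sqsubset> a" using adm n by (simp add: admissible_def x_def)
    then have ag: "agree k x a"
      using lex_between_agree[OF b(2) \<open>b \<sqsubseteq> x\<close>] b(2) unfolding lex_le_def
      by (blast intro: agree_trans agree_sym)
    then have "x 0 = A" using b(3) a(2) by (simp add: agree_def)
    then have "mirror A (tail (Suc n + k) c) \<sqsubset> a"
      using admissible_tail_mirror_less[OF adm a(2,3), of "Suc n"] a(4) b(3) by (simp add: x_def tail_apply)
    moreover have "tail k x \<sqsubset> tail k a" using ag \<open>x \<sqsubset> a\<close> lex_tail_iff by blast
    then have "mirror A (tail k a) \<sqsubset> mirror A (tail k x)"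
      using adm a(1) by (subst mirror_antimono_iff) (auto simp: x_def admissible_def tail_apply)
    ultimately show False using bad by (simp add: x_def)
  qed
  have le: "c i \<le> A" for i using adm by (simp add: admissible_def)
  have "mirror A (tail (Suc n) c) \<sqsubset> b" if "0 < c n" for n
    using main[OF admissible_mirror[OF adm], of n] that le[of n] a(4) by (simp add: tail_mirror)
  then show ?thesis using main[OF adm] le by (auto simp: admissible_def)
qed

section \<open>Values of sequences\<close>

text \<open>The value of a sequence read in base \<open>q\<close>, with no restriction on its digits. The sum is
  meaningful for bounded sequences and \<open>q > 1\<close>.\<close>

definition val :: "real \<Rightarrow> (nat \<Rightarrow> nat) \<Rightarrow> real" where
  "val q c = (\<Sum>i. real (c i) / q ^ Suc i)"

definition bounded_seq :: "(nat \<Rightarrow> nat) \<Rightarrow> bool" where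
  "bounded_seq c \<longleftrightarrow> (\<exists>B. \<forall>i. c i \<le> B)"

lemma bounded_seqI: "(\<And>i. c i \<le> B) \<Longrightarrow> bounded_seq c"
  by (auto simp: bounded_seq_def)

lemma bounded_tail [simp]: "bounded_seq c \<Longrightarrow> bounded_seq (tail n c)"
  by (auto simp: bounded_seq_def tail_apply)

lemma infinite_tail [simp]:
  assumes "infinite_seq c"
  shows "infinite_seq (tail n c)"
  unfolding infinite_seq_def
proof
  assume "finite {i. tail n c i \<noteq> 0}"
  then have "finite ({..<n} \<union> (\<lambda>i. n + i) ` {i. tail n c i \<noteq> 0})" by simp
  moreover have "{i. c i \<noteq> 0} \<subseteq> {..<n} \<union> (\<lambda>i. n + i) ` {i. tail n c i \<noteq> 0}"
  proof
    fix i assume "i \<in> {i. c i \<noteq> 0}"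
    then show "i \<in> {..<n} \<union> (\<lambda>i. n + i) ` {i. tail n c i \<noteq> 0}"
      by (cases "i < n") (auto simp: tail_apply intro!: image_eqI[of _ _ "i - n"])
  qed
  ultimately show False using assms finite_subset unfolding infinite_seq_def by blast
qed

lemma infinite_of_tail:
  assumes "infinite_seq (tail n c)"
  shows "infinite_seq c"
  unfolding infinite_seq_def
proof
  assume "finite {i. c i \<noteq> 0}"
  then have "finite ((\<lambda>i. n + i) -` {i. c i \<noteq> 0})" by (rule finite_vimageI) simp
  then show False using assms by (simp add: infinite_seq_def tail_apply vimage_def)
qed

lemma infinite_nonzero: "infinite_seq c \<Longrightarrow> \<exists>i. 0 < c i"
  unfolding infinite_seq_def by (metis (mono_tags, lifting) Collect_empty_eq finite.emptyI neq0_conv)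

lemma inverse_power_sums:
  fixes q :: real
  assumes "1 < q"
  shows "(\<lambda>i. B / q ^ Suc i) sums (B / (q - 1))"
proof -
  have "(\<lambda>i. (B / q) * (1 / q) ^ i) sums ((B / q) * (1 / (1 - 1 / q)))"
    using assms by (intro sums_mult geometric_sums) auto
  moreover have "(B / q) * (1 / (1 - 1 / q)) = B / (q - 1)"
    using assms by (simp add: field_simps)
  moreover have "(\<lambda>i. (B / q) * (1 / q) ^ i) = (\<lambda>i. B / q ^ Suc i)"
    by (simp add: field_simps)
  ultimately show ?thesis by (simp only:)
qed

lemma summable_val:
  assumes "1 < q" "bounded_seq c"
  shows "summable (\<lambda>i. real (c i) / q ^ Suc i)"
proof -
  obtain B where B: "\<And>i. c i \<le> B" using assms(2) by (auto simp: bounded_seq_def)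
  show ?thesis
  proof (rule summable_comparison_test')
    show "summable (\<lambda>i. real B / q ^ Suc i)" using inverse_power_sums[OF assms(1)] by (rule sums_summable)
    show "norm (real (c i) / q ^ Suc i) \<le> real B / q ^ Suc i" for i
      using assms(1) B[of i] by (simp add: divide_right_mono)
  qed
qed

lemma val_sums: "1 < q \<Longrightarrow> bounded_seq c \<Longrightarrow> (\<lambda>i. real (c i) / q ^ Suc i) sums val q c"
  unfolding val_def by (rule summable_sums[OF summable_val])

lemma val_split:
  assumes "1 < q" "bounded_seq c"
  shows "val q c = (\<Sum>i<n. real (c i) / q ^ Suc i) + val q (tail n c) / q ^ n"
proof -
  have "(\<lambda>i. real (c (i + n)) / q ^ Suc (i + n)) sums
      (val q c - (\<Sum>i<n. real (c i) / q ^ Suc i))"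
    using val_sums[OF assms] by (rule sums_split_initial_segment)
  moreover have "(\<lambda>i. (real (tail n c i) / q ^ Suc i) / q ^ n) sums (val q (tail n c) / q ^ n)"
    using assms by (intro sums_divide val_sums) auto
  moreover have "(real (tail n c i) / q ^ Suc i) / q ^ n = real (c (i + n)) / q ^ Suc (i + n)" for i
    by (simp add: power_add ac_simps tail_apply)
  ultimately have "val q c - (\<Sum>i<n. real (c i) / q ^ Suc i) = val q (tail n c) / q ^ n"
    using sums_unique2 by simp
  then show ?thesis by simp
qed

lemma val_nonneg: "1 < q \<Longrightarrow> bounded_seq c \<Longrightarrow> 0 \<le> val q c"
  unfolding val_def by (intro suminf_nonneg summable_val) auto

lemma val_pos:
  assumes "1 < q" "bounded_seq c" "\<exists>i. 0 < c i"
  shows "0 < val q c"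
proof -
  obtain m where "0 < c m" using assms(3) by auto
  then show ?thesis unfolding val_def using assms
    by (intro suminf_pos2[where i = m] summable_val) auto
qed

lemma val_const: "1 < q \<Longrightarrow> val q (\<lambda>_. A) = A / (q - 1)"
  unfolding val_def by (rule sums_unique[OF inverse_power_sums, symmetric])

lemma val_le: "1 < q \<Longrightarrow> (\<And>i. c i \<le> (B :: nat)) \<Longrightarrow> val q c \<le> B / (q - 1)"
  unfolding val_const[symmetric] val_def
  by (intro suminf_le summable_val) (auto intro!: divide_right_mono bounded_seqI)

lemma val_mirror:
  assumes "1 < q" "\<And>i. c i \<le> A"
  shows "val q (mirror A c) = A / (q - 1) - val q c"
proof -
  have "(\<lambda>i. real A / q ^ Suc i - real (c i) / q ^ Suc i) sums (A / (q - 1) - val q c)"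
    using assms by (intro sums_diff inverse_power_sums val_sums bounded_seqI)
  moreover have "real A / q ^ Suc i - real (c i) / q ^ Suc i = real (mirror A c i) / q ^ Suc i" for i
    using assms(2)[of i] by (simp add: of_nat_diff diff_divide_distrib)
  ultimately have "(\<lambda>i. real (mirror A c i) / q ^ Suc i) sums (A / (q - 1) - val q c)"
    by (simp only:)
  then show ?thesis unfolding val_def[of q "mirror A c"] by (rule sums_unique[symmetric])
qed

lemma val_diff:
  assumes "1 < q" "bounded_seq c" "bounded_seq d" "agree n c d"
  shows "val q c = val q d +
    (real (c n) - real (d n) + val q (tail (Suc n) c) - val q (tail (Suc n) d)) / q ^ Suc n"
proof -
  have "(\<Sum>i<n. real (c i) / q ^ Suc i) = (\<Sum>i<n. real (d i) / q ^ Suc i)"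
    using assms(4) by (intro sum.cong) (auto simp: agree_def)
  then show ?thesis
    using val_split[OF assms(1,2), of "Suc n"] val_split[OF assms(1,3), of "Suc n"]
    by (simp add: add_divide_distrib diff_divide_distrib)
qed

lemma val_base_antimono:
  assumes "1 < q" "q < s" "bounded_seq c" "\<exists>i. 0 < c i"
  shows "val s c < val q c"
proof -
  obtain m where m: "0 < c m" using assms(4) by auto
  let ?d = "\<lambda>i. real (c i) / q ^ Suc i - real (c i) / s ^ Suc i"
  have sums: "?d sums (val q c - val s c)" using assms by (intro sums_diff val_sums) auto
  have "0 \<le> ?d i" for i
    using assms by (auto intro!: divide_left_mono power_mono mult_pos_pos simp del: power_Suc)
  moreover have "0 < ?d m"
    using assms m by (auto intro!: divide_strict_left_mono power_strict_mono mult_pos_pos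
        simp del: power_Suc)
  ultimately have "0 < suminf ?d" by (intro suminf_pos2[OF sums_summable[OF sums]])
  then show ?thesis using sums_unique[OF sums] by linarith
qed

lemma expansion_bounded: "expansion q x c \<Longrightarrow> bounded_seq c"
  unfolding expansion_def bounded_seq_def
  by (rule exI[of _ "nat \<lceil>q\<rceil>"]) (meson less_imp_le of_nat_le_iff order_trans real_nat_ceiling_ge)

lemma expansion_iff:
  assumes "1 < q"
  shows "expansion q x c \<longleftrightarrow> (\<forall>i. real (c i) < q) \<and> val q c = x"
proof -
  have "bounded_seq c" if "\<forall>i. real (c i) < q"
    unfolding bounded_seq_def
    by (rule exI[of _ "nat \<lceil>q\<rceil>"])
      (meson that less_imp_le of_nat_le_iff order_trans real_nat_ceiling_ge)
  then show ?thesis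
    using val_sums[OF assms, of c] sums_unique2 unfolding expansion_def by blast
qed

section \<open>The quasi-greedy expansion of 1\<close>

text \<open>Comparison of values with the help of a sequence \<open>a\<close> of value 1: if no tail of \<open>c\<close> exceeds
  \<open>a\<close>, then \<open>c\<close> has value at most 1. At the first difference \<open>c\<close> loses at least one unit against
  \<open>a\<close> and regains at most the value of its tail; so an upper bound \<open>1 + e\<close> for the values of all
  tails improves to \<open>1 + e / q\<close>.\<close>

lemma val_le_1:
  assumes "1 < q" "bounded_seq a" "bounded_seq c" "val q a = 1" "\<And>n. tail n c \<sqsubseteq> a"
  shows "val q c \<le> 1"
proof -
  obtain B where B: "\<And>i. c i \<le> B" using assms(3) by (auto simp: bounded_seq_def)
  define K where "K = real B / (q - 1)"
  have K: "0 \<le> K" using assms(1) by (simp add: K_def)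
  have "val q (tail n c) \<le> 1 + K / q ^ j" for n j
  proof (induction j arbitrary: n)
    case 0
    have "val q (tail n c) \<le> K" unfolding K_def using B by (intro val_le assms(1)) (simp add: tail_apply)
    then show ?case by simp
  next
    case (Suc j)
    show ?case
    proof (cases "tail n c = a")
      case True
      then show ?thesis using K assms(1,4) by simp
    next
      case False
      then have "tail n c \<sqsubset> a" using assms(5)[of n] by (simp add: lex_le_def)
      then obtain m where m: "tail n c m < a m" "agree m (tail n c) a" by (rule lex_lessE)
      have "val q (tail n c) = val q a + (real (tail n c m) - real (a m)
          + val q (tail (Suc m) (tail n c)) - val q (tail (Suc m) a)) / q ^ Suc m"
        using assms(1-3) m(2) by (intro val_diff) auto
      also have "\<dots> \<le> 1 + (K / q ^ j) / q ^ Suc m"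
      proof -
        have "real (tail n c m) - real (a m) \<le> -1" using m(1) by simp
        then have "real (tail n c m) - real (a m) + val q (tail (Suc m) (tail n c))
            - val q (tail (Suc m) a) \<le> K / q ^ j"
          using Suc[of "n + Suc m"] val_nonneg[of q "tail (Suc m) a"] assms(1,2)
          by simp
        then show ?thesis
          using assms(1) unfolding assms(4) by (intro add_left_mono divide_right_mono) auto
      qed
      also have "(K / q ^ j) / q ^ Suc m = (K / q ^ Suc j) / q ^ m"
        by simp
      also have "\<dots> \<le> K / q ^ Suc j"
        using K assms(1) divide_left_mono[of 1 "q ^ m" "K / q ^ Suc j"] by simp
      finally show ?thesis by simp
    qed
  qed
  from this[of 0] have "val q c \<le> 1 + K / q ^ j" for j by simp
  moreover have "(\<lambda>j. 1 + K / q ^ j) \<longlonglongrightarrow> 1 + 0"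
    using assms(1) by (intro tendsto_add tendsto_const LIMSEQ_divide_realpow_zero) simp
  ultimately show ?thesis by (intro LIMSEQ_le_const[of _ "1 + 0 :: real", simplified]) auto
qed

lemma val_less_1:
  assumes "1 < q" "bounded_seq a" "bounded_seq c" "val q a = 1" "\<And>n. tail n c \<sqsubseteq> a"
    and "infinite_seq a" "c \<sqsubset> a"
  shows "val q c < 1"
proof -
  obtain m where m: "c m < a m" "agree m c a" using assms(7) by (rule lex_lessE)
  have "val q (tail (Suc m) c) \<le> 1"
    using assms by (intro val_le_1[of q a]) auto
  moreover have "0 < val q (tail (Suc m) a)"
    using assms infinite_nonzero[of "tail (Suc m) a"] by (intro val_pos) auto
  moreover have "real (c m) - real (a m) \<le> -1" using m(1) by simp
  ultimately have "real (c m) - real (a m) + val q (tail (Suc m) c) - val q (tail (Suc m) a) < 0"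
    by linarith
  then have "(real (c m) - real (a m) + val q (tail (Suc m) c) - val q (tail (Suc m) a))
      / q ^ Suc m < 0" using assms(1) by (intro divide_neg_pos) auto
  then show ?thesis using val_diff[OF assms(1,3,2) m(2)] assms(4) by linarith
qed

text \<open>In the other direction the values, not the tails themselves, of \<open>a\<close> have to be controlled.\<close>

lemma val_ge_1:
  assumes "1 < q" "bounded_seq a" "bounded_seq c" "val q a = 1"
    and "\<And>n. val q (tail n a) \<le> 1" "a \<sqsubset> c"
  shows "1 \<le> val q c" "infinite_seq c \<Longrightarrow> 1 < val q c"
proof -
  obtain m where m: "a m < c m" "agree m a c" using assms(6) by (rule lex_lessE)
  let ?D = "real (c m) - real (a m) + val q (tail (Suc m) c) - val q (tail (Suc m) a)"
  have eq: "val q c = 1 + ?D / q ^ Suc m"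
    using val_diff[OF assms(1,3,2) agree_sym[OF m(2)]] assms(4) by simp
  have D: "val q (tail (Suc m) c) \<le> ?D"
    using m(1) assms(5)[of "Suc m"] by simp
  have "0 \<le> val q (tail (Suc m) c)" using assms by (intro val_nonneg) auto
  then show "1 \<le> val q c" using D eq assms(1) by simp
  assume "infinite_seq c"
  then have "0 < val q (tail (Suc m) c)"
    using assms infinite_nonzero[of "tail (Suc m) c"] by (intro val_pos) auto
  then show "1 < val q c" using D eq assms(1) by simp
qed

text \<open>The quasi-greedy expansion has all its tails of value at most 1; being a bounded
  infinite sequence of value 1 with this property characterizes it.\<close>

definition quasi :: "real \<Rightarrow> (nat \<Rightarrow> nat) \<Rightarrow> bool" where
  "quasi q a \<longleftrightarrow> bounded_seq a \<and> infinite_seq a \<and> val q a = 1 \<and> (\<forall>n. val q (tail n a) \<le> 1)"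

lemma quasi_digit_less:
  assumes "1 < q" "quasi q a"
  shows "real (a n) < q"
proof -
  have "0 < val q (tail (Suc n) a)"
    using assms infinite_nonzero[of "tail (Suc n) a"] by (intro val_pos) (auto simp: quasi_def)
  moreover have "val q (tail n a) = (real (a n) + val q (tail (Suc n) a)) / q"
    using val_split[of q "tail n a" 1] assms by (simp add: quasi_def add_divide_distrib tail_apply)
  moreover have "val q (tail n a) \<le> 1" using assms(2) by (simp add: quasi_def)
  ultimately show ?thesis using assms(1) by (simp add: divide_le_eq)
qed

lemma quasi_greedy_eq:
  assumes q: "1 < q" and a: "quasi q a"
  shows "quasi_greedy q = a"
proof -
  have exp: "expansion q 1 a"
    using q a quasi_digit_less[OF q a] by (simp add: expansion_iff quasi_def)
  have max: "d \<sqsubseteq> a" if "expansion q 1 d" "infinite_seq d" for d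
  proof (rule ccontr)
    assume "\<not> d \<sqsubseteq> a"
    then have "a \<sqsubset> d" by (simp add: lex.not_le)
    then have "1 < val q d"
      using val_ge_1(2)[of q a d] a q that expansion_bounded by (simp add: quasi_def)
    then show False using that(1) q by (simp add: expansion_iff)
  qed
  show ?thesis unfolding quasi_greedy_def
  proof (rule the_equality)
    fix c assume c: "expansion q 1 c \<and> infinite_seq c \<and>
      (\<forall>d. expansion q 1 d \<and> infinite_seq d \<longrightarrow> d \<sqsubseteq> c)"
    then have "a \<sqsubseteq> c" "c \<sqsubseteq> a" using exp max a by (auto simp: quasi_def)
    then show "c = a" by simp
  qed (use exp max a in \<open>auto simp: quasi_def\<close>)
qed

text \<open>The remainders of the quasi-greedy algorithm, which never lets a remainder reach 0.\<close>

fun quasi_rem :: "real \<Rightarrow> nat \<Rightarrow> real" where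
  "quasi_rem q 0 = 1"
| "quasi_rem q (Suc n) = q * quasi_rem q n - real (nat (\<lceil>q * quasi_rem q n\<rceil> - 1))"

lemma quasi_exists:
  assumes q: "1 < q"
  shows "\<exists>a. quasi q a"
proof -
  define a where "a n = nat (\<lceil>q * quasi_rem q n\<rceil> - 1)" for n
  have rem: "0 < quasi_rem q n \<and> quasi_rem q n \<le> 1" for n
  proof (induction n)
    case (Suc n)
    then have "0 < q * quasi_rem q n" using q by simp
    then have "real (nat (\<lceil>q * quasi_rem q n\<rceil> - 1)) = of_int \<lceil>q * quasi_rem q n\<rceil> - 1"
      by simp
    then show ?case using ceiling_correct[of "q * quasi_rem q n"] by auto
  qed simp
  have Suc: "quasi_rem q (Suc n) = q * quasi_rem q n - real (a n)" for n by (simp add: a_def)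
  have less: "real (a n) < q" for n
  proof -
    have "real (a n) < q * quasi_rem q n" using rem[of "Suc n"] unfolding Suc by linarith
    also have "\<dots> \<le> q * 1" using q rem[of n] by (intro mult_left_mono) auto
    finally show ?thesis by simp
  qed
  have bd: "bounded_seq a"
    using less by (intro bounded_seqI[of _ "nat \<lceil>q\<rceil>"]) (meson less_imp_le of_nat_le_iff order_trans real_nat_ceiling_ge)
  have part: "(\<Sum>i<n. real (a i) / q ^ Suc i) = 1 - quasi_rem q n / q ^ n" for n
  proof (induction n)
    case (Suc n)
    have "real (a n) = q * quasi_rem q n - quasi_rem q (Suc n)" using Suc by (simp add: a_def)
    then have "real (a n) / q ^ Suc n = quasi_rem q n / q ^ n - quasi_rem q (Suc n) / q ^ Suc n"
      using q by (simp only: diff_divide_distrib) simp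
    then show ?case using Suc by (simp del: quasi_rem.simps)
  qed simp
  have "(\<lambda>n. quasi_rem q n / q ^ n) \<longlonglongrightarrow> 0"
  proof (rule tendsto_sandwich[of "\<lambda>_. 0" _ _ "\<lambda>n. 1 / q ^ n"])
    show "(\<lambda>n. 1 / q ^ n) \<longlonglongrightarrow> 0" using q by (intro LIMSEQ_divide_realpow_zero) simp
  qed (use rem q in \<open>auto intro!: always_eventually divide_right_mono simp: less_imp_le\<close>)
  then have "(\<lambda>n. 1 - quasi_rem q n / q ^ n) \<longlonglongrightarrow> 1 - 0" by (intro tendsto_diff tendsto_const)
  then have "(\<lambda>i. real (a i) / q ^ Suc i) sums 1" unfolding sums_def part by simp
  then have val: "val q a = 1" unfolding val_def by (rule sums_unique[symmetric])
  have tail: "val q (tail n a) = quasi_rem q n" for n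
    using val_split[OF q bd, of n] q unfolding val part by simp
  have "infinite_seq a"
    unfolding infinite_seq_def
  proof
    assume "finite {i. a i \<noteq> 0}"
    then obtain n where n: "\<forall>i\<in>{i. a i \<noteq> 0}. i < n" using finite_nat_set_iff_bounded by blast
    then have "a (n + i) = 0" for i using not_add_less1[of n i] by blast
    then have "tail n a = (\<lambda>_. 0)" by (simp add: tail_def)
    then have "val q (tail n a) = 0" by (simp add: val_def)
    then show False using tail rem[of n] by simp
  qed
  then have "quasi q a" using bd val tail rem by (simp add: quasi_def)
  then show ?thesis by blast
qed

lemma quasi_quasi_greedy: "1 < q \<Longrightarrow> quasi q (quasi_greedy q)"
  using quasi_exists quasi_greedy_eq by metis

lemma
  assumes "1 < q"
  shows quasi_greedy_bounded [simp]: "bounded_seq (quasi_greedy q)"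
    and quasi_greedy_infinite [simp]: "infinite_seq (quasi_greedy q)"
    and val_quasi_greedy [simp]: "val q (quasi_greedy q) = 1"
    and val_tail_quasi_greedy: "val q (tail n (quasi_greedy q)) \<le> 1"
    and quasi_greedy_digit_less: "real (quasi_greedy q i) < q"
  using quasi_quasi_greedy[OF assms] quasi_digit_less[OF assms quasi_quasi_greedy[OF assms]]
  by (auto simp: quasi_def)

lemma tail_quasi_greedy_le:
  assumes "1 < q"
  shows "tail n (quasi_greedy q) \<sqsubseteq> quasi_greedy q"
proof (rule ccontr)
  assume "\<not> tail n (quasi_greedy q) \<sqsubseteq> quasi_greedy q"
  then have "quasi_greedy q \<sqsubset> tail n (quasi_greedy q)" by (simp add: lex.not_le)
  then have "1 < val q (tail n (quasi_greedy q))"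
    using assms by (intro val_ge_1(2)[of q "quasi_greedy q"]) (auto simp: val_tail_quasi_greedy)
  then show False using val_tail_quasi_greedy[OF assms, of n] by simp
qed

lemma quasi_greedy_le_head: "1 < q \<Longrightarrow> quasi_greedy q n \<le> quasi_greedy q 0"
  using lex_le_head[OF tail_quasi_greedy_le[of q n]] by (simp add: tail_apply)

lemma quasi_greedy_eqI:
  assumes "1 < q" "bounded_seq b" "infinite_seq b" "val q b = 1" "\<And>n. tail n b \<sqsubseteq> b"
  shows "quasi_greedy q = b"
proof -
  have "val q (tail n b) \<le> 1" for n
    using assms by (intro val_le_1[of q b]) auto
  then show ?thesis using assms by (intro quasi_greedy_eq) (auto simp: quasi_def)
qed

lemma quasi_greedy_strict_mono:
  assumes "1 < q" "q < s"
  shows "quasi_greedy q \<sqsubset> quasi_greedy s"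
proof (rule ccontr)
  assume "\<not> quasi_greedy q \<sqsubset> quasi_greedy s"
  then have le: "quasi_greedy s \<sqsubseteq> quasi_greedy q" by (simp add: lex.not_less)
  have "tail n (quasi_greedy s) \<sqsubseteq> quasi_greedy q" for n
    using lex.order_trans[OF tail_quasi_greedy_le[of s n] le] assms by simp
  then have "val q (quasi_greedy s) \<le> 1"
    using assms by (intro val_le_1[of q "quasi_greedy q"]) auto
  moreover have "val s (quasi_greedy s) < val q (quasi_greedy s)"
    using assms infinite_nonzero[of "quasi_greedy s"] by (intro val_base_antimono) auto
  ultimately show False using assms by simp
qed

lemma quasi_greedy_less_iff:
  "1 < q \<Longrightarrow> 1 < s \<Longrightarrow> quasi_greedy q \<sqsubset> quasi_greedy s \<longleftrightarrow> q < s"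
  by (cases q s rule: linorder_cases)
    (use quasi_greedy_strict_mono[of q s] quasi_greedy_strict_mono[of s q]
        less_fun_asym[of "quasi_greedy s" "quasi_greedy q"] in simp_all)

lemma quasi_greedy_head_ge:
  assumes "1 < q"
  shows "q \<le> real (quasi_greedy q 0) + 1"
proof -
  have "1 = real (quasi_greedy q 0) / q + val q (tail 1 (quasi_greedy q)) / q"
    using val_split[OF assms quasi_greedy_bounded[OF assms], of 1] unfolding val_quasi_greedy[OF assms]
    by (simp only: One_nat_def lessThan_Suc lessThan_0 sum.insert finite.emptyI empty_iff sum.empty) simp
  then have "q = real (quasi_greedy q 0) + val q (tail 1 (quasi_greedy q))"
    using assms by (simp add: field_simps)
  then show ?thesis using val_tail_quasi_greedy[OF assms, of 1] by linarith
qed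

lemma quasi_greedy_head_pos: "1 < q \<Longrightarrow> 0 < quasi_greedy q 0"
  using quasi_greedy_head_ge[of q] by (cases "quasi_greedy q 0") auto

lemma digit_less_iff:
  assumes "1 < q"
  shows "real d < q \<longleftrightarrow> d \<le> quasi_greedy q 0"
proof
  show "real d < q" if "d \<le> quasi_greedy q 0"
    using that quasi_greedy_digit_less[OF assms, of 0] by linarith
  show "d \<le> quasi_greedy q 0" if "real d < q"
  proof -
    have "real d < real (quasi_greedy q 0 + 1)"
      using that quasi_greedy_head_ge[OF assms] by simp
    then show ?thesis by linarith
  qed
qed

lemma quasi_greedy_head_mono:
  assumes "1 < q" "q \<le> s"
  shows "quasi_greedy q 0 \<le> quasi_greedy s 0"
  using quasi_greedy_digit_less[OF assms(1), of 0] assms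
  by (intro digit_less_iff[of s, THEN iffD1]) auto

section \<open>The lexicographic characterization of unique expansions\<close>

text \<open>The remainders of the greedy algorithm for \<open>x\<close> with largest digit \<open>A\<close>.\<close>

fun greedy_rem :: "nat \<Rightarrow> real \<Rightarrow> real \<Rightarrow> nat \<Rightarrow> real" where
  "greedy_rem A q x 0 = x"
| "greedy_rem A q x (Suc n) =
     q * greedy_rem A q x n - real (min A (nat \<lfloor>q * greedy_rem A q x n\<rfloor>))"

text \<open>With digits \<open>0, \<dots>, A\<close>, where \<open>q \<le> A + 1\<close>, the greedy algorithm expands every number
  between the two extreme values.\<close>

lemma expansion_exists:
  assumes q: "1 < q" "q \<le> real A + 1" and x: "0 \<le> x" "x \<le> real A / (q - 1)"
  shows "\<exists>c. (\<forall>i. c i \<le> A) \<and> val q c = x"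
proof -
  define r where "r = greedy_rem A q x"
  define c where "c n = min A (nat \<lfloor>q * r n\<rfloor>)" for n
  have Suc: "r (Suc n) = q * r n - real (c n)" for n by (simp add: r_def c_def)
  have rem: "0 \<le> r n \<and> r n \<le> A / (q - 1)" for n
  proof (induction n)
    case (Suc n)
    then have pos: "0 \<le> q * r n" using q by simp
    show ?case
    proof (cases "nat \<lfloor>q * r n\<rfloor> \<le> A")
      case True
      then have "real (c n) = of_int \<lfloor>q * r n\<rfloor>" using pos by (simp add: c_def)
      then have "0 \<le> r (Suc n)" "r (Suc n) \<le> 1"
        unfolding \<open>r (Suc n) = _\<close> by linarith+
      moreover have "1 \<le> A / (q - 1)" using q by (simp add: le_divide_eq)
      ultimately show ?thesis by linarith
    next
      case False
      then have c: "c n = A" by (simp add: c_def)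
      have "real A \<le> q * r n" using False pos by linarith
      moreover have "q * r n \<le> q * (A / (q - 1))" using Suc q by (intro mult_left_mono) auto
      moreover have "q * (A / (q - 1)) - A = A / (q - 1)" using q by (simp add: field_simps)
      ultimately show ?thesis unfolding \<open>r (Suc n) = _\<close> c by linarith
    qed
  qed (use x in \<open>simp add: r_def\<close>)
  have part: "(\<Sum>i<n. real (c i) / q ^ Suc i) = x - r n / q ^ n" for n
  proof (induction n)
    case 0
    then show ?case by (simp add: r_def)
  next
    case (Suc n)
    have "real (c n) / q ^ Suc n = r n / q ^ n - r (Suc n) / q ^ Suc n"
      using q unfolding \<open>r (Suc n) = _\<close> by (simp add: diff_divide_distrib)
    then show ?case using Suc by simp
  qed
  have "(\<lambda>n. r n / q ^ n) \<longlonglongrightarrow> 0"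
  proof (rule tendsto_sandwich[of "\<lambda>_. 0" _ _ "\<lambda>n. (A / (q - 1)) / q ^ n"])
    show "(\<lambda>n. (A / (q - 1)) / q ^ n) \<longlonglongrightarrow> 0" using q by (intro LIMSEQ_divide_realpow_zero) simp
    have "r n / q ^ n \<le> (A / (q - 1)) / q ^ n" for n
      using rem[of n] q by (intro divide_right_mono) auto
    then show "\<forall>\<^sub>F n in sequentially. r n / q ^ n \<le> (A / (q - 1)) / q ^ n" by simp
  qed (use rem q in auto)
  then have "(\<lambda>n. x - r n / q ^ n) \<longlonglongrightarrow> x - 0" by (intro tendsto_diff tendsto_const)
  then have "(\<lambda>i. real (c i) / q ^ Suc i) sums x" unfolding sums_def part by simp
  then have "val q c = x" unfolding val_def by (rule sums_unique[symmetric])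
  moreover have "\<forall>i. c i \<le> A" by (simp add: c_def)
  ultimately show ?thesis by blast
qed

lemma univoque_seqs_iff:
  assumes "1 < q"
  shows "c \<in> univoque_seqs q \<longleftrightarrow> (\<forall>i. c i \<le> quasi_greedy q 0) \<and>
    (\<forall>d. (\<forall>i. d i \<le> quasi_greedy q 0) \<and> val q d = val q c \<longrightarrow> d = c)"
proof -
  have "expansion q x d \<longleftrightarrow> (\<forall>i. d i \<le> quasi_greedy q 0) \<and> val q d = x" for x d
    using assms by (simp add: expansion_iff digit_less_iff)
  then have "c \<in> univoque_seqs q \<longleftrightarrow> (\<forall>i. c i \<le> quasi_greedy q 0) \<and>
      (\<exists>!d. (\<forall>i. d i \<le> quasi_greedy q 0) \<and> val q d = val q c)"
    unfolding univoque_seqs_def univoque_set_def by auto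
  then show ?thesis unfolding Ex1_def by (metis (mono_tags, lifting))
qed

lemma admissible_val_less:
  assumes q: "1 < q" and adm: "admissible (quasi_greedy q 0) (quasi_greedy q) c"
    and d: "\<And>i. d i \<le> quasi_greedy q 0" and less: "c \<sqsubset> d"
  shows "val q c < val q d"
proof -
  obtain n where n: "c n < d n" "agree n c d" using less by (rule lex_lessE)
  have bd: "bounded_seq c" "bounded_seq d"
    using adm d by (auto simp: admissible_def intro!: bounded_seqI[of _ "quasi_greedy q 0"])
  have "tail (Suc n + m) c \<sqsubset> quasi_greedy q" for m
    using n(1) d[of n]
    by (intro admissible_tail_less[OF adm refl tail_quasi_greedy_le[OF q], of n]) auto
  from this[of 0] this have "val q (tail (Suc n) c) < 1"
    using q bd by (intro val_less_1[of q "quasi_greedy q"]) (auto simp: lex_le_def)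
  moreover have "0 \<le> val q (tail (Suc n) d)" using q bd by (intro val_nonneg) auto
  moreover have "1 \<le> real (d n) - real (c n)" using n(1) by linarith
  ultimately have "0 < (real (d n) - real (c n) + val q (tail (Suc n) d) - val q (tail (Suc n) c))
      / q ^ Suc n"
    using q by (intro divide_pos_pos) auto
  then show ?thesis using val_diff[OF q bd(2,1) agree_sym[OF n(2)]] by linarith
qed

lemma univoque_seqs_mirror:
  assumes q: "1 < q" and c: "c \<in> univoque_seqs q"
  shows "mirror (quasi_greedy q 0) c \<in> univoque_seqs q"
proof -
  let ?A = "quasi_greedy q 0"
  have le: "\<And>i. c i \<le> ?A"
    and uniq: "\<And>d. (\<And>i. d i \<le> ?A) \<Longrightarrow> val q d = val q c \<Longrightarrow> d = c"
    using c univoque_seqs_iff[OF q] by auto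
  have "d = mirror ?A c" if d: "\<And>i. d i \<le> ?A" and "val q d = val q (mirror ?A c)" for d
  proof -
    have "val q (mirror ?A d) = val q c"
      using that val_mirror[OF q d] val_mirror[OF q le] by simp
    then have "mirror ?A d = c" by (intro uniq) auto
    then show ?thesis using mirror_mirror[OF d] by auto
  qed
  then show ?thesis using univoque_seqs_iff[OF q] by auto
qed

text \<open>If the tail after a digit \<open>c n < A\<close> has value at least 1, one unit can be moved from it to
  the digit.\<close>

lemma univoque_tail_less:
  assumes q: "1 < q" and c: "c \<in> univoque_seqs q" and n: "c n < quasi_greedy q 0"
  shows "tail (Suc n) c \<sqsubset> quasi_greedy q"
proof (rule ccontr)
  let ?A = "quasi_greedy q 0" and ?t = "tail (Suc n) c"
  have le: "\<And>i. c i \<le> ?A"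
    and uniq: "\<And>d. (\<And>i. d i \<le> ?A) \<Longrightarrow> val q d = val q c \<Longrightarrow> d = c"
    using c univoque_seqs_iff[OF q] by auto
  have bd: "bounded_seq c" using le by (rule bounded_seqI)
  assume "\<not> ?t \<sqsubset> quasi_greedy q"
  then have "quasi_greedy q = ?t \<or> quasi_greedy q \<sqsubset> ?t" by (auto simp: lex.not_less lex_le_def)
  then have "1 \<le> val q ?t"
  proof
    show ?thesis if "quasi_greedy q = ?t" using q val_quasi_greedy[OF q] that by simp
    show ?thesis if "quasi_greedy q \<sqsubset> ?t"
      using that q bd val_ge_1(1)[of q "quasi_greedy q" ?t] by (simp add: val_tail_quasi_greedy)
  qed
  moreover have "val q ?t \<le> ?A / (q - 1)" using q le by (intro val_le) (auto simp: tail_apply)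
  ultimately obtain e where e: "\<And>i. e i \<le> ?A" "val q e = val q ?t - 1"
    using expansion_exists[of q ?A "val q ?t - 1"] q quasi_greedy_head_ge[OF q] by auto
  define d where "d i = (if i < n then c i else if i = n then c n + 1 else e (i - Suc n))" for i
  have d: "d i \<le> ?A" for i using le n e(1) by (auto simp: d_def)
  have "tail (Suc n) d = e" by (simp add: d_def tail_def)
  then have "val q d = val q c"
    using val_diff[of q d c n] q bd e(2) bounded_seqI[of d, OF d]
    by (simp add: agree_def d_def)
  then have "d = c" using d by (intro uniq)
  then have "d n = c n" by simp
  then show False by (simp add: d_def)
qed

lemma univoque_seqs_eq_admissible:
  assumes q: "1 < q"
  shows "c \<in> univoque_seqs q \<longleftrightarrow> admissible (quasi_greedy q 0) (quasi_greedy q) c"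
proof
  let ?A = "quasi_greedy q 0"
  assume c: "c \<in> univoque_seqs q"
  have le: "\<And>i. c i \<le> ?A" using c univoque_seqs_iff[OF q] by auto
  have "mirror ?A (tail (Suc n) c) \<sqsubset> quasi_greedy q" if "0 < c n" for n
    using univoque_tail_less[OF q univoque_seqs_mirror[OF q c], of n] that le[of n]
    by (simp add: tail_mirror)
  then show "admissible ?A (quasi_greedy q) c"
    using le univoque_tail_less[OF q c] by (auto simp: admissible_def)
next
  let ?A = "quasi_greedy q 0"
  assume adm: "admissible ?A (quasi_greedy q) c"
  have le: "\<And>i. c i \<le> ?A" using adm by (simp add: admissible_def)
  have "d = c" if d: "\<And>i. d i \<le> ?A" and eq: "val q d = val q c" for d
  proof (rule ccontr)
    assume "d \<noteq> c"
    then consider "c \<sqsubset> d" | "d \<sqsubset> c" by (rule lex.neqE[of d c]) auto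
    then show False
    proof cases
      case 1
      then show False using admissible_val_less[OF q adm _ 1] d eq by simp
    next
      case 2
      then have "mirror ?A c \<sqsubset> mirror ?A d" using mirror_antimono_iff[OF le d] by simp
      then have "val q (mirror ?A c) < val q (mirror ?A d)"
        using admissible_val_less[OF q admissible_mirror[OF adm], of "mirror ?A d"] by simp
      then show False using eq val_mirror[OF q d] val_mirror[OF q le] by simp
    qed
  qed
  then show "c \<in> univoque_seqs q" using le univoque_seqs_iff[OF q] by auto
qed

section \<open>The sets of bases\<close>

lemma V_bases_iff:
  "q \<in> \<V> \<longleftrightarrow> 1 < q \<and>
    (\<forall>k\<ge>1. mirror (quasi_greedy q 0) (tail k (quasi_greedy q)) \<sqsubseteq> quasi_greedy q)"
  by (simp add: V_bases_def reflect_def mirror_def tail_def)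

text \<open>The bases for which the inequalities defining \<open>\<V>\<close> are strict; this set turns out to be the
  part of \<open>closure \<U>\<close> above 1.\<close>

definition strict_bases :: "real set" where
  "strict_bases = {q. 1 < q \<and>
    (\<forall>k\<ge>1. mirror (quasi_greedy q 0) (tail k (quasi_greedy q)) \<sqsubset> quasi_greedy q)}"

lemma strict_bases_subset_V: "strict_bases \<subseteq> \<V>"
  by (auto simp: strict_bases_def V_bases_iff lex_le_def)

lemma univoque_bases_iff:
  "q \<in> \<U> \<longleftrightarrow> 1 < q \<and> admissible (quasi_greedy q 0) (quasi_greedy q) (quasi_greedy q)"
proof (cases "1 < q")
  case True
  then have "expansion q x (quasi_greedy q) \<longleftrightarrow> x = 1" for x
    by (auto simp: expansion_iff quasi_greedy_digit_less)
  then have "q \<in> \<U> \<longleftrightarrow> quasi_greedy q \<in> univoque_seqs q"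
    using True by (auto simp: univoque_bases_def univoque_seqs_def univoque_set_def)
  then show ?thesis using univoque_seqs_eq_admissible[OF True] True by simp
qed (simp add: univoque_bases_def)

lemma univoque_bases_subset_strict: "\<U> \<subseteq> strict_bases"
proof
  fix q assume "q \<in> \<U>"
  then have q: "1 < q" and adm: "admissible (quasi_greedy q 0) (quasi_greedy q) (quasi_greedy q)"
    by (auto simp: univoque_bases_iff)
  then show "q \<in> strict_bases"
    using admissible_tail_mirror_less[OF adm refl tail_quasi_greedy_le[OF q]]
      quasi_greedy_head_pos[OF q] by (auto simp: strict_bases_def)
qed

lemma strict_base_univoqueI:
  assumes "q \<in> strict_bases"
    and "\<And>k. 1 \<le> k \<Longrightarrow> tail k (quasi_greedy q) \<noteq> quasi_greedy q"
  shows "q \<in> \<U>"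
proof -
  have q: "1 < q" using assms(1) by (simp add: strict_bases_def)
  have "tail (Suc n) (quasi_greedy q) \<sqsubset> quasi_greedy q" for n
    using tail_quasi_greedy_le[OF q, of "Suc n"] assms(2)[of "Suc n"] by (simp add: lex_le_def)
  then show ?thesis using assms(1) q quasi_greedy_le_head[OF q]
    by (auto simp: univoque_bases_iff admissible_def strict_bases_def)
qed

section \<open>Comparing two bases\<close>

lemma univoque_seqs_eqI:
  assumes "1 < t" "t < s" "agree k (quasi_greedy t) (quasi_greedy s)" "1 \<le> k"
    and bad: "quasi_greedy s \<sqsubseteq> mirror (quasi_greedy s 0) (tail k (quasi_greedy s))"
  shows "univoque_seqs t = univoque_seqs s"
proof -
  have s: "1 < s" using assms by simp
  have less: "quasi_greedy t \<sqsubset> quasi_greedy s" using assms by (intro quasi_greedy_strict_mono)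
  have head: "quasi_greedy t 0 = quasi_greedy s 0" using assms(3,4) by (simp add: agree_def)
  have "admissible (quasi_greedy s 0) (quasi_greedy t) c"
    if "admissible (quasi_greedy s 0) (quasi_greedy s) c" for c
    by (rule admissible_shrink[OF that quasi_greedy_le_head[OF s] refl tail_quasi_greedy_le[OF s]
          quasi_greedy_head_pos[OF s] less assms(3,4) bad])
  then have "admissible (quasi_greedy t 0) (quasi_greedy t) c \<longleftrightarrow>
      admissible (quasi_greedy s 0) (quasi_greedy s) c" for c
    unfolding head using admissible_mono[OF _ less] by blast
  then show ?thesis using univoque_seqs_eq_admissible assms(1) s by auto
qed

text \<open>A base \<open>t\<close> of \<open>\<V>\<close> separates the bases \<open>s \<le> t\<close> from the bases \<open>q > t\<close>: unless there are more
  digits in base \<open>q\<close>, the sequence \<open>0\<close> followed by the quasi-greedy expansion of 1 in base \<open>t\<close>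
  is a unique expansion in base \<open>q\<close> but not in base \<open>s\<close>.\<close>

lemma univoque_seqs_neqI:
  assumes "1 < s" "s \<le> t" "t < q" and t: "t \<in> \<V>"
  shows "univoque_seqs s \<noteq> univoque_seqs q"
proof -
  have q: "1 < q" and t1: "1 < t" using assms by auto
  have le: "quasi_greedy s 0 \<le> quasi_greedy t 0" "quasi_greedy t 0 \<le> quasi_greedy q 0"
    using assms by (auto intro: quasi_greedy_head_mono)
  let ?A = "quasi_greedy q 0"
  show ?thesis
  proof (cases "quasi_greedy s 0 = ?A")
    case False
    have "mirror ?A (\<lambda>_. ?A) \<sqsubset> quasi_greedy q"
      using quasi_greedy_head_pos[OF q] by (intro lex_lessI[of _ 0]) (auto simp: agree_def)
    then have "admissible ?A (quasi_greedy q) (\<lambda>_. ?A)"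
      by (simp add: admissible_def tail_def)
    moreover have "\<not> admissible (quasi_greedy s 0) (quasi_greedy s) (\<lambda>_. ?A)"
      using le False by (auto simp: admissible_def)
    ultimately show ?thesis using univoque_seqs_eq_admissible q assms(1) by blast
  next
    case True
    then have head: "quasi_greedy t 0 = ?A" using le by simp
    define c where "c = case_nat 0 (quasi_greedy t)"
    have c_tail: "tail (Suc n) c = tail n (quasi_greedy t)" for n
      by (simp add: c_def tail_def)
    have less: "quasi_greedy t \<sqsubset> quasi_greedy q"
      using t1 assms(3) by (rule quasi_greedy_strict_mono)
    have "c i \<le> ?A" for i
      using quasi_greedy_le_head[OF t1] head by (cases i) (auto simp: c_def)
    moreover have "tail (Suc n) c \<sqsubset> quasi_greedy q" for n
      unfolding c_tail using tail_quasi_greedy_le[OF t1] less by (rule lex.le_less_trans)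
    moreover have "mirror ?A (tail (Suc n) c) \<sqsubset> quasi_greedy q" if "0 < c n" for n
    proof -
      have "1 \<le> n" using that by (cases n) (auto simp: c_def)
      then have "mirror ?A (tail n (quasi_greedy t)) \<sqsubseteq> quasi_greedy t"
        using t head by (simp add: V_bases_iff)
      then show ?thesis unfolding c_tail using less by (rule lex.le_less_trans)
    qed
    ultimately have "admissible ?A (quasi_greedy q) c" by (simp add: admissible_def)
    then have "c \<in> univoque_seqs q" using univoque_seqs_eq_admissible[OF q] by simp
    moreover have "c \<notin> univoque_seqs s"
    proof
      assume "c \<in> univoque_seqs s"
      then have "admissible (quasi_greedy s 0) (quasi_greedy s) c"
        using univoque_seqs_eq_admissible[OF assms(1)] by simp
      moreover have "c 0 = 0" by (simp add: c_def)
      ultimately have "tail (Suc 0) c \<sqsubset> quasi_greedy s"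
        using quasi_greedy_head_pos[OF assms(1)] unfolding admissible_def by metis
      then have "t < s" using c_tail[of 0] t1 assms(1) by (simp add: quasi_greedy_less_iff)
      then show False using assms(2) by simp
    qed
    ultimately show ?thesis by blast
  qed
qed

section \<open>One-sided limits of the quasi-greedy expansion\<close>

lemma quasi_greedy_left_continuous:
  assumes q: "1 < q"
  shows "\<exists>l. 1 < l \<and> l < q \<and> (\<forall>t. l < t \<and> t < q \<longrightarrow> agree M (quasi_greedy t) (quasi_greedy q))"
proof -
  let ?a = "quasi_greedy q"
  define c where "c i = (if i < M then ?a i else 0)" for i
  have c_val: "val t c = (\<Sum>i<M. real (?a i) / t ^ Suc i)" for t
    unfolding val_def by (subst suminf_finite[of "{..<M}"]) (auto simp: c_def)
  have c_bd: "bounded_seq c"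
    using quasi_greedy_le_head[OF q] by (auto simp: c_def intro!: bounded_seqI[of _ "?a 0"])
  have "0 < val q (tail M ?a)"
    using q infinite_nonzero[of "tail M ?a"] by (intro val_pos) auto
  then have "0 < val q (tail M ?a) / q ^ M" using q by simp
  then have "val q c < 1"
    using val_split[of q ?a M] q unfolding c_val by simp
  moreover have "((\<lambda>t. val t c) \<longlongrightarrow> val q c) (at_left q)"
    unfolding c_val using q by (intro tendsto_intros) auto
  ultimately have "\<forall>\<^sub>F t in at_left q. val t c < 1" by (rule order_tendstoD(2)[rotated])
  moreover have "\<forall>\<^sub>F t in at_left q. 1 < t" using q by (rule order_tendstoD(1)[OF tendsto_ident_at])
  ultimately have "\<forall>\<^sub>F t in at_left q. 1 < t \<and> val t c < 1" by eventually_elim simp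
  then obtain b where b: "b < q" "\<And>t. b < t \<Longrightarrow> t < q \<Longrightarrow> 1 < t \<and> val t c < 1"
    unfolding eventually_at_left_field by blast
  have agr: "agree M (quasi_greedy t) ?a" if t: "b < t" "t < q" for t
  proof -
    have t1: "1 < t" "val t c < 1" using b(2)[OF t] by auto
    have "c \<sqsubseteq> quasi_greedy t"
    proof (rule ccontr)
      assume "\<not> c \<sqsubseteq> quasi_greedy t"
      then have "quasi_greedy t \<sqsubset> c" by (simp add: lex.not_le)
      then have "1 \<le> val t c"
        using t1(1) c_bd by (intro val_ge_1(1)[of t "quasi_greedy t"]) (auto simp: val_tail_quasi_greedy)
      then show False using t1(2) by simp
    qed
    moreover have "quasi_greedy t \<sqsubseteq> ?a"
      using quasi_greedy_strict_mono[OF t1(1) t(2)] by (simp add: lex_le_def)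
    moreover have "agree M c ?a" by (simp add: agree_def c_def)
    ultimately show ?thesis using lex_between_agree agree_trans agree_sym by blast
  qed
  show ?thesis
    using agr b(1) q by (intro exI[of _ "max b ((1 + q) / 2)"]) (auto simp: less_max_iff_disj)
qed

text \<open>The limit from the right is the sequence of value 1 all of whose proper tails have value less
  than 1. For a base \<open>q\<close> that is not an integer this is the greedy expansion of 1.\<close>

lemma quasi_greedy_right_limit:
  assumes q: "1 < q" and g: "bounded_seq g" "val q g = 1"
    and tails: "\<And>j. 1 \<le> j \<Longrightarrow> val q (tail j g) < 1"
  shows "\<exists>r>q. \<forall>s. q < s \<and> s < r \<longrightarrow> agree M (quasi_greedy s) g"
proof -
  define F where "F j s = (\<Sum>i<j. real (g i) / s ^ Suc i) + (real (g j) + 1) / s ^ Suc j" for j s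
  have "\<forall>\<^sub>F s in at_right q. 1 < F j s" for j
  proof -
    have "val q (tail (Suc j) g) / q ^ Suc j < 1 / q ^ Suc j"
      using tails[of "Suc j"] q by (intro divide_strict_right_mono) auto
    then have "1 < F j q"
      using val_split[OF q g(1), of "Suc j"] unfolding F_def g(2) by (simp add: add_divide_distrib)
    moreover have "(F j \<longlongrightarrow> F j q) (at_right q)"
      unfolding F_def using q by (intro tendsto_intros) auto
    ultimately show ?thesis by (rule order_tendstoD(1)[rotated])
  qed
  then have "\<forall>\<^sub>F s in at_right q. \<forall>j\<in>{..<M}. 1 < F j s" by (intro eventually_ball_finite) auto
  then obtain r where r: "q < r" "\<And>s j. q < s \<Longrightarrow> s < r \<Longrightarrow> j < M \<Longrightarrow> 1 < F j s"
    unfolding eventually_at_right_field by blast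
  have "agree M (quasi_greedy s) g" if s: "q < s" "s < r" for s
  proof (rule ccontr)
    have s1: "1 < s" using q s by simp
    have "\<exists>i. 0 < g i"
    proof (rule ccontr)
      assume "\<nexists>i. 0 < g i"
      then have "val q g = 0" by (simp add: val_def)
      then show False using g(2) by simp
    qed
    then have less: "val s g < 1"
      using val_base_antimono[OF q s(1) g(1)] g(2) by simp
    have above: "g \<sqsubseteq> quasi_greedy s"
    proof (rule ccontr)
      assume "\<not> g \<sqsubseteq> quasi_greedy s"
      then have "quasi_greedy s \<sqsubset> g" by (simp add: lex.not_le)
      then have "1 \<le> val s g"
        using s1 g by (intro val_ge_1(1)[of s "quasi_greedy s"]) (auto simp: val_tail_quasi_greedy)
      then show False using less by simp
    qed
    assume nag: "\<not> agree M (quasi_greedy s) g"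
    then have "g \<noteq> quasi_greedy s" by (auto simp: agree_def)
    then have "g \<sqsubset> quasi_greedy s" using above by (simp add: lex_le_def)
    then obtain j where j: "g j < quasi_greedy s j" "agree j g (quasi_greedy s)" by (rule lex_lessE)
    have "j < M" using nag agree_mono[OF agree_sym[OF j(2)], of M] by (meson not_less)
    have "F j s \<le> (\<Sum>i<Suc j. real (quasi_greedy s i) / s ^ Suc i)"
    proof -
      have "(\<Sum>i<j. real (g i) / s ^ Suc i) = (\<Sum>i<j. real (quasi_greedy s i) / s ^ Suc i)"
        using j(2) by (intro sum.cong) (auto simp: agree_def)
      moreover have "real (g j) + 1 \<le> real (quasi_greedy s j)" using j(1) by linarith
      then have "(real (g j) + 1) / s ^ Suc j \<le> real (quasi_greedy s j) / s ^ Suc j"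
        using s1 by (intro divide_right_mono) auto
      ultimately show ?thesis unfolding F_def by simp
    qed
    also have "\<dots> \<le> 1"
    proof -
      have "0 \<le> val s (tail (Suc j) (quasi_greedy s)) / s ^ Suc j"
        using s1 by (intro divide_nonneg_pos val_nonneg) auto
      then show ?thesis using val_split[of s "quasi_greedy s" "Suc j"] s1 by simp
    qed
    finally show False using r(2)[OF s \<open>j < M\<close>] by simp
  qed
  then show ?thesis using r(1) by blast
qed

lemma val_tail_less_1:
  assumes "1 < q" "tail j (quasi_greedy q) \<noteq> quasi_greedy q"
  shows "val q (tail j (quasi_greedy q)) < 1"
  using assms tail_quasi_greedy_le[OF assms(1)]
  by (intro val_less_1[of q "quasi_greedy q"]) (auto simp: lex_le_def)

text \<open>If the quasi-greedy expansion has smallest period \<open>N\<close>, the limit from the right is finite: it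
  consists of the first \<open>N\<close> digits of the quasi-greedy expansion, the last of them increased by 1,
  followed by zeros. For an integer \<open>q\<close>, where \<open>N = 1\<close>, its first term is \<open>q\<close> itself.\<close>

definition bump :: "nat \<Rightarrow> (nat \<Rightarrow> nat) \<Rightarrow> nat \<Rightarrow> nat" where
  "bump N a i = (if Suc i < N then a i else if Suc i = N then Suc (a i) else 0)"

lemma tail_bump: "N \<le> j \<Longrightarrow> tail j (bump N a) = (\<lambda>_. 0)"
  by (rule ext) (simp add: tail_apply bump_def)

lemma agree_bump: "n < N \<Longrightarrow> agree n (bump N a) a"
  by (simp add: agree_def bump_def)

lemma bounded_bump: "bounded_seq a \<Longrightarrow> bounded_seq (bump N a)"
  unfolding bounded_seq_def
proof (elim exE)
  fix B assume "\<forall>i. a i \<le> B"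
  then have "bump N a i \<le> Suc B" for i by (simp add: bump_def le_SucI)
  then show "\<exists>B. \<forall>i. bump N a i \<le> B" by blast
qed

lemma val_tail_bump:
  assumes q: "1 < q" and per: "tail N (quasi_greedy q) = quasi_greedy q" and "j < N"
  shows "val q (tail j (bump N (quasi_greedy q))) = val q (tail j (quasi_greedy q))"
proof -
  let ?a = "quasi_greedy q" and ?n = "N - Suc j"
  have Suc: "j + Suc ?n = N" "Suc (j + ?n) = N" using assms(3) by auto
  have "agree ?n (tail j (bump N ?a)) (tail j ?a)"
    using assms(3) by (intro agree_tail agree_bump) simp
  moreover have "val q (\<lambda>_. 0) = 0" by (simp add: val_def)
  moreover have "tail j (bump N ?a) ?n = Suc (tail j ?a ?n)"
    using Suc(2) by (simp add: tail_apply bump_def)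
  ultimately show ?thesis
    using val_diff[of q "tail j (bump N ?a)" "tail j ?a" ?n] q per
    by (simp add: bounded_bump Suc tail_bump)
qed

lemma periodic_right_limit:
  assumes q: "1 < q" and N: "1 \<le> N" "tail N (quasi_greedy q) = quasi_greedy q"
    and min: "\<And>j. 1 \<le> j \<Longrightarrow> j < N \<Longrightarrow> tail j (quasi_greedy q) \<noteq> quasi_greedy q"
  shows "\<exists>r>q. \<forall>s. q < s \<and> s < r \<longrightarrow> agree M (quasi_greedy s) (bump N (quasi_greedy q))"
proof (rule quasi_greedy_right_limit[OF q])
  let ?g = "bump N (quasi_greedy q)"
  show "bounded_seq ?g" using q by (intro bounded_bump) simp
  show "val q ?g = 1" using val_tail_bump[OF q N(2), of 0] N(1) q by simp
  fix j :: nat assume "1 \<le> j"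
  show "val q (tail j ?g) < 1"
  proof (cases "j < N")
    case True
    then show ?thesis using val_tail_bump[OF q N(2) True] val_tail_less_1[OF q min[OF \<open>1 \<le> j\<close> True]]
      by simp
  next
    case False
    then show ?thesis by (simp add: tail_bump val_def)
  qed
qed

lemma less_const_seq:
  assumes "\<And>i. c i \<le> A" "c m < A"
  shows "c \<sqsubset> (\<lambda>_. A)"
proof (rule ccontr)
  assume "\<not> c \<sqsubset> (\<lambda>_. A)"
  then consider "(\<lambda>_. A) \<sqsubset> c" | "(\<lambda>_. A) = c" by (auto simp: lex.not_less lex_le_def)
  then show False
  proof cases
    case 1
    then obtain n where "A < c n" by (rule lex_lessE)
    then show False using assms(1)[of n] by simp
  next
    case 2
    then show False using assms(2) by auto
  qed
qed

text \<open>A violation of the inequalities defining \<open>\<V>\<close> in a sequence of period \<open>N\<close> can be found within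
  a single period: it says that \<open>a p + a (k + p) < A\<close> while \<open>a i + a (k + i) = A\<close> for \<open>i < p\<close>, a
  condition that is symmetric under exchange of the two occurrences.\<close>

lemma violation_within_period:
  assumes per: "\<And>i. a (N + i) = a i" and N: "1 \<le> N" and A: "\<And>i. a i \<le> A" "a 0 = A" "0 < A"
    and viol: "1 \<le> k" "a \<sqsubset> mirror A (tail k a)"
  obtains k' p where "1 \<le> k'" "k' + p < N" "a p + a (k' + p) < A" "\<And>i. i < p \<Longrightarrow> a i + a (k' + i) = A"
proof -
  have mod: "a (i mod N) = a i" for i
  proof (induction i rule: less_induct)
    case (less i)
    show ?case
    proof (cases "i < N")
      case False
      then have "a ((i - N) mod N) = a (i - N)" using N by (intro less) simp
      then show ?thesis using False per[of "i - N"] by (simp add: le_mod_geq)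
    qed simp
  qed
  obtain p where p: "a p < mirror A (tail k a) p" "agree p a (mirror A (tail k a))"
    using viol(2) by (rule lex_lessE)
  define h where "h = k mod N"
  have "a (h + i) = a (k + i)" for i
    using mod[of "h + i"] mod[of "k + i"] by (simp add: h_def mod_add_left_eq)
  then have lt: "a p + a (h + p) < A" and eq: "\<And>i. i < p \<Longrightarrow> a i + a (h + i) = A"
    using p A(1) by (auto simp: agree_def tail_apply less_diff_conv)
  have "h \<noteq> 0"
  proof
    assume "h = 0"
    then show False using lt eq[of 0] A by (cases "p = 0") auto
  qed
  have "h < N" using N by (simp add: h_def)
  have "p < N"
  proof (rule ccontr)
    assume "\<not> p < N"
    then show False using eq[of "p - N"] lt per[of "p - N"] per[of "h + (p - N)"] N
      by (simp add: add.left_commute)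
  qed
  show thesis
  proof (cases "h + p < N")
    case True
    then show thesis using that[of h p] lt eq \<open>h \<noteq> 0\<close> by simp
  next
    case False
    define p' where "p' = h + p - N"
    have p': "N + p' = h + p" "N - h + p' = p" using False \<open>h < N\<close> by (auto simp: p'_def)
    have "a p' + a (N - h + p') < A" using lt per[of p'] p' by simp
    moreover have "a i + a (N - h + i) = A" if "i < p'" for i
    proof -
      have "N - h + i < p" "h + (N - h + i) = N + i" using that p' \<open>h < N\<close> by auto
      then show ?thesis using eq[of "N - h + i"] per[of i] by simp
    qed
    ultimately show thesis using that[of "N - h" p'] \<open>h < N\<close> \<open>p < N\<close> p' by simp
  qed
qed

text \<open>The right limit \<open>g\<close> violates the inequalities defining \<open>\<V>\<close> as soon as the expansion in
  base \<open>q\<close> fails to satisfy them strictly. If \<open>q \<notin> \<V>\<close>, the violation moreover occurs for a \<open>k\<close>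
  that does not exceed the length of the common prefix of \<open>g\<close> and the expansion in base \<open>q\<close>.\<close>

lemma right_limit_violation:
  assumes q: "1 < q" "q \<notin> strict_bases"
  obtains k g where "1 \<le> k" "g 0 = quasi_greedy q 0" "g \<sqsubset> mirror (quasi_greedy q 0) (tail k g)"
    "q \<notin> \<V> \<longrightarrow> agree k g (quasi_greedy q)"
    "\<forall>M. \<exists>r>q. \<forall>s. q < s \<and> s < r \<longrightarrow> agree M (quasi_greedy s) g"
proof -
  let ?a = "quasi_greedy q"
  let ?A = "?a 0"
  have le: "\<And>i. ?a i \<le> ?A" using q(1) by (rule quasi_greedy_le_head)
  have pos: "0 < ?A" using q(1) by (rule quasi_greedy_head_pos)
  show thesis
  proof (cases "\<exists>N\<ge>1. tail N ?a = ?a")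
    case False
    then have nper: "tail j ?a \<noteq> ?a" if "1 \<le> j" for j using that by blast
    obtain k where k: "1 \<le> k" "\<not> mirror ?A (tail k ?a) \<sqsubset> ?a"
      using q by (auto simp: strict_bases_def)
    have "?a \<noteq> mirror ?A (tail k ?a)"
    proof
      assume eq: "?a = mirror ?A (tail k ?a)"
      have "mirror ?A ?a = mirror ?A (mirror ?A (tail k ?a))" using eq by simp
      also have "\<dots> = tail k ?a" using le by (intro mirror_mirror) (simp add: tail_apply)
      finally have "tail k ?a = mirror ?A ?a" by simp
      then have "tail k (tail k ?a) = ?a" using eq by (simp only: tail_mirror)
      then show False using nper[of "k + k"] k(1) by simp
    qed
    then have "?a \<sqsubset> mirror ?A (tail k ?a)" using k(2) by (auto simp: lex.not_less lex_le_def)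
    moreover have "\<exists>r>q. \<forall>s. q < s \<and> s < r \<longrightarrow> agree M (quasi_greedy s) ?a" for M
      using q(1) val_tail_less_1[OF q(1) nper] by (intro quasi_greedy_right_limit) auto
    ultimately show thesis using that[of k ?a] k(1) by (simp add: agree_def)
  next
    case True
    define N where "N = (LEAST N. 1 \<le> N \<and> tail N ?a = ?a)"
    have N: "1 \<le> N" "tail N ?a = ?a" using LeastI_ex[OF True] by (auto simp: N_def)
    have min: "tail j ?a \<noteq> ?a" if "1 \<le> j" "j < N" for j
      using not_less_Least[of j "\<lambda>N. 1 \<le> N \<and> tail N ?a = ?a"] that by (auto simp: N_def)
    have per: "?a (N + i) = ?a i" for i using fun_cong[OF N(2), of i] by (simp add: tail_apply)
    have "N \<noteq> 1"
    proof
      assume "N = 1"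
      then have "?a i = ?A" for i using per by (induction i) auto
      from this[of "k + 0" for k] have "mirror ?A (tail k ?a) \<sqsubset> ?a" for k
        using pos by (intro lex_lessI[of _ 0]) (simp_all only: agree_def tail_apply mirror_apply, simp_all)
      then show False using q by (simp add: strict_bases_def)
    qed
    then have N2: "2 \<le> N" using N(1) by simp
    \<comment> \<open>A last digit \<open>A\<close> of the period would make 1 a period.\<close>
    have last: "?a (N - 1) < ?A"
    proof (rule ccontr)
      assume "\<not> ?a (N - 1) < ?A"
      then have "agree 1 (tail (N - 1) ?a) ?a" using le[of "N - 1"] by (simp add: agree_def tail_apply)
      then have "tail 1 (tail (N - 1) ?a) \<sqsubseteq> tail 1 ?a"
        using tail_quasi_greedy_le[OF q(1)] lex_le_tail_iff by blast
      then have "?a \<sqsubseteq> tail 1 ?a" using N by simp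
      then have "tail 1 ?a = ?a" using tail_quasi_greedy_le[OF q(1)] lex.order_antisym by blast
      then show False using min[of 1] N2 by simp
    qed
    let ?g = "bump N ?a"
    have g_le: "?g i \<le> ?A" for i
    proof (cases "Suc i = N")
      case True
      then show ?thesis using last by (auto simp: bump_def)
    next
      case False
      then show ?thesis using le by (simp add: bump_def)
    qed
    have g0: "?g 0 = ?A" using N2 by (simp add: bump_def)
    have g_zero: "?g i = 0" if "N \<le> i" for i using that by (simp add: bump_def)
    have lim: "\<exists>r>q. \<forall>s. q < s \<and> s < r \<longrightarrow> agree M (quasi_greedy s) ?g" for M
      using q(1) N min by (rule periodic_right_limit)
    show thesis
    proof (cases "q \<in> \<V>")
      case True
      have "mirror ?A (tail N ?g) = (\<lambda>_. ?A)" by (simp add: tail_bump mirror_def)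
      then have "?g \<sqsubset> mirror ?A (tail N ?g)"
        using less_const_seq[of ?g ?A N] g_le g_zero pos by simp
      then show thesis using that[of N ?g] N(1) g0 lim True by blast
    next
      case False
      then obtain k0 where "1 \<le> k0" "?a \<sqsubset> mirror ?A (tail k0 ?a)"
        using q(1) by (auto simp: V_bases_iff lex.not_le)
      then obtain k p where k: "1 \<le> k" "k + p < N" "?a p + ?a (k + p) < ?A"
        and eq: "\<And>i. i < p \<Longrightarrow> ?a i + ?a (k + i) = ?A"
        using violation_within_period[where a = ?a, OF per N(1) le refl pos] by blast
      have agp: "agree p ?g (mirror ?A (tail k ?g))"
        unfolding agree_def
      proof (intro allI impI)
        fix i assume "i < p"
        then show "?g i = mirror ?A (tail k ?g) i"
          using eq[of i] k(2) by (simp add: bump_def tail_apply)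
      qed
      have gp: "?g p = ?a p" using k by (simp add: bump_def)
      have "?g \<sqsubset> mirror ?A (tail k ?g)"
      proof (cases "?g p + ?g (k + p) < ?A")
        case True
        then show ?thesis using agp by (intro lex_lessI[of _ p]) (auto simp: tail_apply)
      next
        case False
        \<comment> \<open>The increased digit makes up for a violation by 1; the zeros after it decide.\<close>
        then have kp: "Suc (k + p) = N" using k by (auto simp: gp bump_def split: if_splits)
        then have "?g (k + p) = Suc (?a (k + p))" by (simp add: bump_def)
        then have "?g p + ?g (k + p) = ?A" using False k(3) gp by simp
        then have "agree (Suc p) ?g (mirror ?A (tail k ?g))"
          using agp by (auto simp: agree_def tail_apply less_Suc_eq)
        moreover have "mirror ?A (tail (k + Suc p) ?g) = (\<lambda>_. ?A)"
          using kp by (simp add: tail_bump mirror_def)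
        moreover have "tail (Suc p) ?g \<sqsubset> (\<lambda>_. ?A)"
          using g_le g_zero pos by (intro less_const_seq[of _ _ N]) (auto simp: tail_apply)
        ultimately show ?thesis
          using lex_tail_iff[of "Suc p" ?g "mirror ?A (tail k ?g)"] by (simp add: tail_mirror)
      qed
      then show thesis using that[of k ?g] k g0 lim agree_bump[of k N ?a] by auto
    qed
  qed
qed

section \<open>Bases that are not strict\<close>

lemma right_neighbourhood:
  assumes q: "1 < q" "q \<notin> strict_bases"
  shows "\<exists>r>q. \<forall>s. q < s \<and> s < r \<longrightarrow>
    s \<notin> \<V> \<and> (q \<notin> \<V> \<longrightarrow> univoque_seqs q = univoque_seqs s)"
proof -
  let ?A = "quasi_greedy q 0"
  obtain k g where k: "1 \<le> k" and g0: "g 0 = ?A" and viol: "g \<sqsubset> mirror ?A (tail k g)"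
    and agr: "q \<notin> \<V> \<longrightarrow> agree k g (quasi_greedy q)"
    and lim: "\<forall>M. \<exists>r>q. \<forall>s. q < s \<and> s < r \<longrightarrow> agree M (quasi_greedy s) g"
    by (rule right_limit_violation[OF q])
  obtain n where n: "g n < mirror ?A (tail k g) n" "agree n g (mirror ?A (tail k g))"
    using viol by (rule lex_lessE)
  obtain r where r: "q < r" "\<And>s. q < s \<Longrightarrow> s < r \<Longrightarrow> agree (k + Suc n) (quasi_greedy s) g"
    using lim by blast
  have "s \<notin> \<V> \<and> (q \<notin> \<V> \<longrightarrow> univoque_seqs q = univoque_seqs s)" if s: "q < s" "s < r" for s
  proof
    note ag = r(2)[OF s]
    have head: "quasi_greedy s 0 = ?A" using ag g0 by (simp add: agree_def)
    have bad: "quasi_greedy s \<sqsubset> mirror (quasi_greedy s 0) (tail k (quasi_greedy s))"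
      unfolding head
    proof (rule lex_less_agree[OF n])
      show "agree (Suc n) g (quasi_greedy s)"
        using ag by (intro agree_sym[OF agree_mono[OF ag]]) simp
      show "agree (Suc n) (mirror ?A (tail k g)) (mirror ?A (tail k (quasi_greedy s)))"
        by (intro agree_mirror agree_tail agree_sym[OF ag])
    qed
    then show "s \<notin> \<V>" using k by (auto simp: V_bases_iff lex.not_le[symmetric])
    show "q \<notin> \<V> \<longrightarrow> univoque_seqs q = univoque_seqs s"
    proof
      assume "q \<notin> \<V>"
      then have "agree k (quasi_greedy q) (quasi_greedy s)"
        using agree_trans[OF agree_sym[OF agr[rule_format]] agree_sym[OF agree_mono[OF ag, of k]]] by simp
      then show "univoque_seqs q = univoque_seqs s"
        using q(1) s(1) k bad by (intro univoque_seqs_eqI) (auto simp: lex_le_def)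
    qed
  qed
  then show ?thesis using r(1) by blast
qed

lemma left_neighbourhood:
  assumes q: "1 < q" "q \<notin> strict_bases"
  shows "\<exists>l. 1 < l \<and> l < q \<and> (\<forall>t. l < t \<and> t < q \<longrightarrow> univoque_seqs t = univoque_seqs q)"
proof -
  obtain k where k: "1 \<le> k" "\<not> mirror (quasi_greedy q 0) (tail k (quasi_greedy q)) \<sqsubset> quasi_greedy q"
    using q by (auto simp: strict_bases_def)
  obtain l where l: "1 < l" "l < q"
      "\<And>t. l < t \<Longrightarrow> t < q \<Longrightarrow> agree k (quasi_greedy t) (quasi_greedy q)"
    using quasi_greedy_left_continuous[OF q(1), of k] by blast
  have "univoque_seqs t = univoque_seqs q" if "l < t" "t < q" for t
    using that l k by (intro univoque_seqs_eqI) (auto simp: lex.not_less)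
  then show ?thesis using l by blast
qed

lemma closure_subset_strict:
  assumes q: "1 < q" "q \<in> closure \<U>"
  shows "q \<in> strict_bases"
proof (rule ccontr)
  assume ns: "q \<notin> strict_bases"
  obtain r where r: "q < r" "\<And>s. q < s \<Longrightarrow> s < r \<Longrightarrow> s \<notin> \<V>"
    using right_neighbourhood[OF q(1) ns] by blast
  obtain l where l: "1 < l" "l < q" "\<And>t. l < t \<Longrightarrow> t < q \<Longrightarrow> univoque_seqs t = univoque_seqs q"
    using left_neighbourhood[OF q(1) ns] by blast
  obtain u where u: "u \<in> \<U>" "dist u q < min (r - q) (q - l)"
    using q(2) r(1) l(2) unfolding closure_approachable by (metis diff_gt_0_iff_gt min_less_iff_conj)
  have "u \<in> strict_bases" using u(1) univoque_bases_subset_strict by blast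
  then have V: "u \<in> \<V>" and "u \<noteq> q" using strict_bases_subset_V ns by auto
  then consider "q < u" "u < r" | "l < u" "u < q" using u(2) by (auto simp: dist_real_def linorder_neq_iff)
  then show False
  proof cases
    case 1
    then show False using r(2) V by blast
  next
    case 2
    then show False using l univoque_seqs_neqI[of u u q] V by auto
  qed
qed

section \<open>Prescribing the quasi-greedy expansion\<close>

lemma isCont_val:
  assumes "1 < s" "bounded_seq b"
  shows "isCont (\<lambda>t. val t b) s"
proof -
  define r where "r = (1 + s) / 2"
  have r: "1 < r" "r < s" using assms(1) by (auto simp: r_def)
  have powser: "val t b = (1 / t) * (\<Sum>i. real (b i) * (1 / t) ^ i)" if t: "1 < t" for t
  proof -
    have eq: "real (b i) * (1 / t) ^ i = t * (real (b i) / t ^ Suc i)" for i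
      using t by (simp add: power_one_over)
    show ?thesis
      unfolding eq suminf_mult[OF summable_val[OF t assms(2)]] val_def[symmetric] using t by simp
  qed
  have "real (b i) * (1 / r) ^ i = r * (real (b i) / r ^ Suc i)" for i
    using r by (simp add: power_one_over)
  then have "summable (\<lambda>i. real (b i) * (1 / r) ^ i)"
    using summable_mult[OF summable_val[OF r(1) assms(2)], of r] by (simp only:)
  moreover have "norm (1 / s) < norm (1 / r)" using r by (simp add: frac_less2)
  ultimately have "isCont (\<lambda>x. \<Sum>i. real (b i) * x ^ i) (1 / s)" by (rule isCont_powser)
  moreover have "isCont (\<lambda>t. 1 / t) s" using assms(1) by (intro continuous_intros) auto
  ultimately have "isCont (\<lambda>t. (1 / t) * (\<Sum>i. real (b i) * (1 / t) ^ i)) s"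
    by (intro isCont_mult isCont_o2[where g = "\<lambda>x. \<Sum>i. real (b i) * x ^ i" and f = "\<lambda>t. 1 / t"])
  moreover have "\<forall>\<^sub>F t in nhds s. val t b = (1 / t) * (\<Sum>i. real (b i) * (1 / t) ^ i)"
    using eventually_nhds_in_open[of "{1<..}" s] assms(1) by (auto elim!: eventually_mono simp: powser)
  ultimately show ?thesis by (simp add: isCont_cong)
qed

lemma base_between:
  assumes "1 < s" "s < q" and b: "bounded_seq b" "infinite_seq b" "\<And>n. tail n b \<sqsubseteq> b"
    and less: "quasi_greedy s \<sqsubset> b" "b \<sqsubset> quasi_greedy q"
  obtains t where "s < t" "t < q" "quasi_greedy t = b"
proof -
  have q: "1 < q" using assms by simp
  have "tail n b \<sqsubseteq> quasi_greedy q" for n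
    using lex.order_trans[OF b(3) lex.less_imp_le[OF less(2)]] .
  then have "val q b < 1"
    using q b less by (intro val_less_1[of q "quasi_greedy q"]) auto
  moreover have "1 < val s b"
    using val_ge_1(2)[of s "quasi_greedy s" b] assms by (simp add: val_tail_quasi_greedy)
  moreover have "\<forall>x. s \<le> x \<and> x \<le> q \<longrightarrow> isCont (\<lambda>t. val t b) x"
    using assms(1) b(1) by (auto intro: isCont_val)
  ultimately obtain t where t: "s \<le> t" "t \<le> q" "val t b = 1"
    using IVT2[of "\<lambda>t. val t b" q 1 s] assms(2) by auto
  have "t \<noteq> s" "t \<noteq> q" using t(3) \<open>val q b < 1\<close> \<open>1 < val s b\<close> by auto
  moreover have "quasi_greedy t = b"
    using t b assms(1) by (intro quasi_greedy_eqI) auto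
  ultimately show thesis using t that[of t] by simp
qed

section \<open>Approximation of strict bases from below\<close>

text \<open>\<open>m\<close> is called good for \<open>a\<close> if, for every \<open>k < m\<close>, the reflection of
  \<open>a\<^sub>k, \<dots>, a\<^sub>m\<^sub>-\<^sub>1\<close> differs from the prefix of \<open>a\<close> of the same length. If \<open>m\<close> is not good, take
  the smallest \<open>k\<close> for which equality holds, and move \<open>m\<close> just behind the place where equality
  first fails.\<close>

lemma good_length_exists:
  assumes A: "\<And>i. a i \<le> A" "a 0 = A" "0 < A" and tails: "\<And>k. tail k a \<sqsubseteq> a"
    and strict: "\<And>k. 1 \<le> k \<Longrightarrow> mirror A (tail k a) \<sqsubset> a"
  obtains m where "M \<le> m" "1 \<le> m" "\<And>k. k < m \<Longrightarrow> \<exists>i. k + i < m \<and> a (k + i) + a i \<noteq> A"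
proof -
  define E where "E k m \<longleftrightarrow> (\<forall>i. k + i < m \<longrightarrow> a (k + i) + a i = A)" for k m
  have "\<exists>m. M \<le> m \<and> 1 \<le> m \<and> (\<forall>k<m. \<not> E k m)"
  proof (rule ccontr)
    assume none: "\<nexists>m. M \<le> m \<and> 1 \<le> m \<and> (\<forall>k<m. \<not> E k m)"
    define m where "m = max M 1"
    have ex: "\<exists>k. k < m \<and> E k m" using none unfolding m_def by (meson max.cobounded1 max.cobounded2)
    define k where "k = (LEAST k. k < m \<and> E k m)"
    have k: "k < m" "E k m" using LeastI_ex[OF ex] by (auto simp: k_def)
    have least: "\<not> E k' m" if "k' < k" for k'
      using not_less_Least[of k' "\<lambda>k. k < m \<and> E k m"] that k(1) by (auto simp: k_def)
    have "k \<noteq> 0"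
    proof
      assume "k = 0"
      then have "a 0 + a 0 = A" using k unfolding E_def by (metis add_0)
      then show False using A by simp
    qed
    then obtain e where e: "mirror A (tail k a) e < a e" "agree e (mirror A (tail k a)) a"
      using strict[of k] by (auto elim: lex_lessE)
    have gt: "A < a (k + e) + a e" using e(1) A(1)[of "k + e"] by (simp add: tail_apply)
    have eq: "a (k + i) + a i = A" if "i < e" for i
    proof -
      have "A - a (k + i) = a i" using e(2) that by (simp add: agree_def tail_apply)
      then show ?thesis using A(1)[of "k + i"] by simp
    qed
    define m' where "m' = Suc (k + e)"
    have "m \<le> k + e"
    proof (rule ccontr)
      assume "\<not> m \<le> k + e"
      then have "a (k + e) + a e = A" using k(2) by (simp add: E_def)
      then show False using gt by simp
    qed
    then have m': "M \<le> m'" "1 \<le> m'" "m \<le> m'" by (auto simp: m'_def m_def)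
    then obtain k' where k': "k' < m'" "E k' m'" using none by blast
    have "E k' m" using k'(2) m'(3) by (simp add: E_def)
    then have "k \<le> k'" using least not_less by blast
    moreover have "k' \<noteq> k" using k'(2) gt by (auto simp: E_def m'_def)
    ultimately have "k < k'" by simp
    define d where "d = k' - k"
    define n where "n = e - d"
    have d: "k' = k + d" "1 \<le> d" "e = d + n" using \<open>k < k'\<close> k'(1) by (auto simp: d_def n_def m'_def)
    have "a i = a (d + i)" if "i < n" for i
    proof -
      have "a (k' + i) + a i = A" using k'(2) that d by (simp add: E_def m'_def)
      moreover have "a (k + (d + i)) + a (d + i) = A" using eq[of "d + i"] that d(3) by simp
      ultimately show ?thesis using d(1) by (simp add: add.assoc)
    qed
    moreover have "a n < a (d + n)"
    proof -
      have "a (k' + n) + a n = A" using k'(2) d by (simp add: E_def m'_def)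
      then show ?thesis using gt d by (simp add: add.assoc)
    qed
    ultimately have "a \<sqsubset> tail d a"
      by (intro lex_lessI[of _ n]) (auto simp: agree_def tail_apply)
    then show False using tails[of d] by (simp add: lex.not_le[symmetric])
  qed
  then obtain m where m: "M \<le> m" "1 \<le> m" "\<forall>k<m. \<not> E k m" by blast
  then have "\<exists>i. k + i < m \<and> a (k + i) + a i \<noteq> A" if "k < m" for k
    using that by (auto simp: E_def)
  then show thesis using that m by blast
qed

text \<open>For good \<open>m\<close> the sequence repeating the block \<open>a\<^sub>0, \<dots>, a\<^sub>m\<^sub>-\<^sub>1\<close> and its reflection in turn
  satisfies all lexicographic inequalities in question and is smaller than \<open>a\<close>.\<close>

lemma approximation_from_below:
  assumes A: "\<And>i. a i \<le> A" "a 0 = A" "0 < A" and tails: "\<And>k. tail k a \<sqsubseteq> a"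
    and strict: "\<And>k. 1 \<le> k \<Longrightarrow> mirror A (tail k a) \<sqsubset> a"
  obtains b where "\<And>i. b i \<le> A" "infinite_seq b" "\<And>k. tail k b \<sqsubseteq> b"
    "\<And>k. mirror A (tail k b) \<sqsubseteq> b" "b \<sqsubset> a" "agree M b a"
proof -
  obtain m where m: "M \<le> m" "1 \<le> m" and good: "\<And>k. k < m \<Longrightarrow> \<exists>i. k + i < m \<and> a (k + i) + a i \<noteq> A"
    using good_length_exists[OF A tails strict, of M] by blast
  define b where "b i = (if even (i div m) then a (i mod m) else A - a (i mod m))" for i
  have b_le: "b i \<le> A" for i using A(1) by (simp add: b_def)
  have b_a: "b i = a i" if "i < m" for i using that by (simp add: b_def)
  then have agr: "agree m b a" by (simp add: agree_def)
  have b_shift: "b (m + i) = A - b i" for i using A(1) m(2) by (simp add: b_def)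
  then have tail_m: "tail m b = mirror A b" by (simp add: tail_def mirror_def)
  have b0: "b 0 = A" using b_a[of 0] A(2) m(2) by simp
  have mm: "mirror A (mirror A (tail k b)) = tail k b" for k
    using b_le by (intro mirror_mirror) (simp add: tail_apply)
  have mirror_less: "mirror A (tail k b) \<sqsubset> b" if k: "k < m" for k
  proof (cases "k = 0")
    case True
    then show ?thesis using b0 A(3) by (intro lex_lessI[of _ 0]) (auto simp: agree_def)
  next
    case False
    then obtain e where e: "mirror A (tail k a) e < a e" "agree e (mirror A (tail k a)) a"
      using strict[of k] by (auto elim: lex_lessE)
    obtain i where i: "k + i < m" "a (k + i) + a i \<noteq> A" using good[OF k] by blast
    have "\<not> i < e"
    proof
      assume "i < e"
      then have "A - a (k + i) = a i" using e(2) by (simp add: agree_def tail_apply)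
      then show False using i(2) A(1)[of "k + i"] by simp
    qed
    then have ke: "k + e < m" using i(1) by simp
    show ?thesis
    proof (rule lex_less_agree[OF e])
      have "agree (k + Suc e) a b" using agree_mono[OF agree_sym[OF agr]] ke by simp
      then show "agree (Suc e) (mirror A (tail k a)) (mirror A (tail k b))"
        by (intro agree_mirror agree_tail)
      show "agree (Suc e) a b" using agree_mono[OF agree_sym[OF agr]] ke by simp
    qed
  qed
  have tail_less: "tail k b \<sqsubset> b" if k: "1 \<le> k" "k < m" for k
  proof (cases "agree (m - k) (tail k a) a")
    case True
    have "agree (k + (m - k)) b a" using agr k by simp
    then have "agree (m - k) (tail k b) (tail k a)" by (rule agree_tail)
    moreover have "agree (m - k) a b" using agree_mono[OF agree_sym[OF agr]] by simp
    ultimately have "agree (m - k) (tail k b) b" using True agree_trans by blast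
    moreover have "tail (m - k) (tail k b) \<sqsubset> tail (m - k) b"
    proof -
      have "mirror A (tail (m - k) b) \<sqsubset> mirror A (mirror A b)"
        using mirror_less[of "m - k"] k b_le by (simp add: mirror_mirror)
      then have "mirror A b \<sqsubset> tail (m - k) b"
        using b_le by (subst (asm) mirror_antimono_iff) (auto simp: tail_apply)
      then show ?thesis using k by (simp add: tail_m)
    qed
    ultimately show ?thesis using lex_tail_iff by blast
  next
    case False
    then have "tail k a \<noteq> a" by (auto simp: agree_def)
    then have "tail k a \<sqsubset> a" using tails[of k] by (simp add: lex_le_def)
    then obtain e where e: "tail k a e < a e" "agree e (tail k a) a" by (rule lex_lessE)
    have "e < m - k" using False agree_mono[OF e(2), of "m - k"] by (meson not_less)
    then have "agree (k + Suc e) a b" using agree_mono[OF agree_sym[OF agr]] by simp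
    then show ?thesis
      by (intro lex_less_agree[OF e]) (auto intro: agree_tail agree_mono)
  qed
  define bounds where "bounds k \<longleftrightarrow> tail k b \<sqsubseteq> b \<and> mirror A (tail k b) \<sqsubseteq> b" for k
  have "bounds k" for k
  proof (induction k rule: less_induct)
    case (less k)
    show ?case
    proof (cases "k < m")
      case True
      then show ?thesis
        using mirror_less[of k] tail_less[of k] by (cases "k = 0") (auto simp: bounds_def lex_le_def)
    next
      case False
      then have "tail k b = mirror A (tail (k - m) b)"
        using tail_tail[of "k - m" m b] by (simp add: tail_m tail_mirror)
      then show ?thesis using less[of "k - m"] False m(2) mm by (simp add: bounds_def)
    qed
  qed
  then have all: "tail k b \<sqsubseteq> b" "mirror A (tail k b) \<sqsubseteq> b" for k
    by (simp_all add: bounds_def)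
  have "infinite_seq b"
    unfolding infinite_seq_def infinite_nat_iff_unbounded_le
  proof
    fix n
    have "b (m * (2 * n)) \<noteq> 0" using A m(2) by (simp add: b_def)
    moreover have "n \<le> m * (2 * n)" using m(2) by (simp add: trans_le_add1)
    ultimately show "\<exists>i\<ge>n. i \<in> {i. b i \<noteq> 0}" by blast
  qed
  moreover have "b \<sqsubset> a"
  proof -
    obtain e where e: "mirror A (tail m a) e < a e" "agree e (mirror A (tail m a)) a"
      using strict[OF m(2)] by (rule lex_lessE)
    have ab: "i < m + e \<Longrightarrow> b i = a i" for i
    proof (induction i rule: less_induct)
      case (less i)
      show ?case
      proof (cases "i < m")
        case False
        define j where "j = i - m"
        have j: "i = m + j" "j < e" "j < i" using False less.prems m(2) by (auto simp: j_def)
        have "A - a (m + j) = a j" using e(2) j(2) by (simp add: agree_def tail_apply)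
        then show ?thesis using less.IH[OF j(3)] less.prems j b_shift[of j] A(1)[of "m + j"] by simp
      qed (rule b_a)
    qed
    have "b (m + e) < a (m + e)"
      using e(1) b_shift[of e] ab[of e] m(2) A(1)[of e] by (simp add: tail_apply)
    then show ?thesis using ab by (intro lex_lessI[of _ "m + e"]) (auto simp: agree_def)
  qed
  moreover have "agree M b a" using agr m(1) by (rule agree_mono)
  ultimately show thesis using that[of b] b_le all by blast
qed

lemma strict_base_limit_of_V:
  assumes q: "q \<in> strict_bases" and s: "1 < s" "s < q"
  obtains t where "t \<in> \<V>" "s < t" "t < q" "agree M (quasi_greedy t) (quasi_greedy q)"
proof -
  let ?a = "quasi_greedy q"
  have q1: "1 < q" using s by simp
  have "quasi_greedy s \<sqsubset> ?a" using s by (rule quasi_greedy_strict_mono)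
  then obtain n where n: "quasi_greedy s n < ?a n" "agree n (quasi_greedy s) ?a" by (rule lex_lessE)
  obtain b where b: "\<And>i. b i \<le> ?a 0" "infinite_seq b" "\<And>k. tail k b \<sqsubseteq> b"
      "\<And>k. mirror (?a 0) (tail k b) \<sqsubseteq> b" "b \<sqsubset> ?a" "agree (max M (Suc n)) b ?a"
    using approximation_from_below[of ?a "?a 0" "max M (Suc n)"] quasi_greedy_le_head[OF q1]
      quasi_greedy_head_pos[OF q1] tail_quasi_greedy_le[OF q1] q
    unfolding strict_bases_def by blast
  have "quasi_greedy s \<sqsubset> b"
    using n by (rule lex_less_agree) (use agree_sym[OF b(6)] in \<open>auto simp: agree_def\<close>)
  then obtain t where t: "s < t" "t < q" "quasi_greedy t = b"
    using base_between[OF s bounded_seqI[of b, OF b(1)] b(2,3) _ b(5)] by blast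
  have "b 0 = ?a 0" using b(6) by (simp add: agree_def)
  then have "t \<in> \<V>" using t s(1) b(4) by (simp add: V_bases_iff)
  moreover have "agree M b ?a" using b(6) by (rule agree_mono) simp
  ultimately show thesis using that t by blast
qed

text \<open>If \<open>q\<close> is strict but \<open>1\<close> has several expansions, then the quasi-greedy expansion \<open>a\<close> is
  periodic. Prefixing one period of \<open>a\<close> to the quasi-greedy expansion in a base of \<open>\<V>\<close> close to
  \<open>q\<close> from below gives the quasi-greedy expansion in a base of \<open>\<U>\<close>.\<close>

lemma strict_base_limit_of_univoque:
  assumes q: "q \<in> strict_bases" "q \<notin> \<U>" and s: "1 < s" "s < q"
  shows "\<exists>u\<in>\<U>. s < u \<and> u < q"
proof -
  let ?a = "quasi_greedy q"
  let ?A = "?a 0"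
  have q1: "1 < q" using s by simp
  have pos: "0 < ?A" using q1 by (rule quasi_greedy_head_pos)
  have ex: "\<exists>N. 1 \<le> N \<and> tail N ?a = ?a" using q strict_base_univoqueI by blast
  define N where "N = (LEAST N. 1 \<le> N \<and> tail N ?a = ?a)"
  have N: "1 \<le> N" "tail N ?a = ?a" using LeastI_ex[OF ex] by (auto simp: N_def)
  have min: "tail k ?a \<noteq> ?a" if "1 \<le> k" "k < N" for k
    using not_less_Least[of k "\<lambda>N. 1 \<le> N \<and> tail N ?a = ?a"] that by (auto simp: N_def)
  \<comment> \<open>Each of the finitely many strict inequalities for \<open>k < N\<close> is decided by a finite prefix.\<close>
  have robust: "\<exists>n. \<forall>c. agree n c ?a \<longrightarrow> tail k c \<sqsubset> c \<and> mirror ?A (tail k c) \<sqsubset> c"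
    if k: "1 \<le> k" "k < N" for k
  proof -
    have "tail k ?a \<sqsubset> ?a"
      using tail_quasi_greedy_le[OF q1, of k] min[OF k] by (simp add: lex_le_def)
    then obtain e where e: "tail k ?a e < ?a e" "agree e (tail k ?a) ?a" by (rule lex_lessE)
    have "mirror ?A (tail k ?a) \<sqsubset> ?a" using q(1) k by (simp add: strict_bases_def)
    then obtain f where f: "mirror ?A (tail k ?a) f < ?a f" "agree f (mirror ?A (tail k ?a)) ?a"
      by (rule lex_lessE)
    have "tail k c \<sqsubset> c \<and> mirror ?A (tail k c) \<sqsubset> c" if "agree (k + Suc (e + f)) c ?a" for c
    proof
      have c: "agree j ?a c" if "j \<le> k + Suc (e + f)" for j
        using agree_mono[OF agree_sym[OF \<open>agree (k + Suc (e + f)) c ?a\<close>]] that by simp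
      show "tail k c \<sqsubset> c" using c by (intro lex_less_agree[OF e] agree_tail) auto
      show "mirror ?A (tail k c) \<sqsubset> c"
        using c by (intro lex_less_agree[OF f] agree_mirror agree_tail) auto
    qed
    then show ?thesis by blast
  qed
  then obtain n where n: "\<And>k c. 1 \<le> k \<Longrightarrow> k < N \<Longrightarrow> agree (n k) c ?a \<Longrightarrow>
      tail k c \<sqsubset> c \<and> mirror ?A (tail k c) \<sqsubset> c" by metis
  define P where "P = (\<Sum>k<N. n k)"
  have P: "n k \<le> P" if "k < N" for k
    unfolding P_def using that by (intro member_le_sum) auto
  obtain t where t: "t \<in> \<V>" "s < t" "t < q" and tN: "agree (N + P) (quasi_greedy t) ?a"
    using strict_base_limit_of_V[OF q(1) s] by blast
  let ?d = "quasi_greedy t"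
  have t1: "1 < t" using s t by simp
  have d_a: "?d \<sqsubset> ?a" using t1 t(3) by (rule quasi_greedy_strict_mono)
  have d0: "?d 0 = ?A" using tN N(1) by (simp add: agree_def)
  define b where "b i = (if i < N then ?a i else ?d (i - N))" for i
  have tail_N: "tail N b = ?d" by (simp add: b_def tail_def)
  have agN: "agree N b ?a" by (simp add: b_def agree_def)
  have b0: "b 0 = ?A" using N(1) by (simp add: b_def)
  have agP: "agree P b ?a"
    unfolding agree_def
  proof (intro allI impI)
    fix i assume i: "i < P"
    show "b i = ?a i"
    proof (cases "i < N")
      case False
      then have "?a i = ?a (i - N)" using fun_cong[OF N(2), of "i - N"] by (simp add: tail_apply)
      then show ?thesis using False i tN by (simp add: b_def agree_def)
    qed (simp add: b_def)
  qed
  have b_a: "b \<sqsubset> ?a" using lex_tail_iff[OF agN] d_a by (simp add: tail_N N(2))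
  have d_b: "?d \<sqsubset> b"
  proof -
    obtain j where j: "?d j < ?a j" "agree j ?d ?a" using d_a by (rule lex_lessE)
    have "N \<le> j" using j(1) tN by (metis agree_def leI less_irrefl trans_less_add1)
    have "tail N ?d \<noteq> ?d"
    proof
      assume "tail N ?d = ?d"
      then have "?d j = ?d (j - N)" "?a j = ?a (j - N)"
        using fun_cong[of _ _ "j - N"] N(2) \<open>N \<le> j\<close> by (metis le_add_diff_inverse tail_apply)+
      then show False using j N(1) \<open>N \<le> j\<close> by (simp add: agree_def)
    qed
    then have "tail N ?d \<sqsubset> tail N b"
      using tail_quasi_greedy_le[OF t1, of N] by (simp add: tail_N lex_le_def)
    moreover have "agree N ?d b"
      using agree_trans[OF agree_mono[OF tN] agree_sym[OF agN]] by simp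
    ultimately show ?thesis using lex_tail_iff by blast
  qed
  have tails: "tail k b \<sqsubset> b \<and> mirror ?A (tail k b) \<sqsubset> b" if "1 \<le> k" for k
  proof (cases "k < N")
    case True
    then show ?thesis using n[OF that True] agree_mono[OF agP P[OF True]] by blast
  next
    case False
    then have eq: "tail k b = tail (k - N) ?d"
      using tail_tail[of "k - N" N b] by (simp add: tail_N)
    have "mirror ?A (tail (k - N) ?d) \<sqsubset> b"
    proof (cases "k = N")
      case True
      then show ?thesis using d0 b0 pos by (intro lex_lessI[of _ 0]) (auto simp: agree_def)
    next
      case neq: False
      then have "mirror ?A (tail (k - N) ?d) \<sqsubseteq> ?d"
        using t(1) False d0 by (simp add: V_bases_iff)
      then show ?thesis using d_b by (rule lex.le_less_trans)
    qed
    moreover have "tail (k - N) ?d \<sqsubset> b"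
      using tail_quasi_greedy_le[OF t1] d_b by (rule lex.le_less_trans)
    ultimately show ?thesis unfolding eq by simp
  qed
  have b_le: "b i \<le> ?A" for i
    using quasi_greedy_le_head[OF q1] quasi_greedy_le_head[OF t1] d0 by (simp add: b_def)
  have "infinite_seq b"
    using infinite_of_tail[of N b] t1 by (simp add: tail_N)
  moreover have "tail k b \<sqsubseteq> b" for k
    using tails[of k] by (cases "k = 0") (auto simp: lex_le_def)
  ultimately obtain u where u: "t < u" "u < q" "quasi_greedy u = b"
    using base_between[OF t1 t(3) bounded_seqI[of b, OF b_le] _ _ d_b b_a] by blast
  have "admissible ?A b b" using b_le tails by (simp add: admissible_def)
  then have "u \<in> \<U>" using u t1 b0 by (simp add: univoque_bases_iff)
  then show ?thesis using u t by (intro bexI[of _ u]) auto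
qed

lemma closure_univoque_bases_iff:
  assumes "1 < q"
  shows "q \<in> closure \<U> \<longleftrightarrow> q \<in> strict_bases"
proof
  assume "q \<in> closure \<U>"
  then show "q \<in> strict_bases" by (rule closure_subset_strict[OF assms])
next
  assume q: "q \<in> strict_bases"
  show "q \<in> closure \<U>"
  proof (cases "q \<in> \<U>")
    case True
    then show ?thesis using closure_subset by blast
  next
    case False
    show ?thesis
      unfolding closure_approachable
    proof (intro allI impI)
      fix e :: real assume "0 < e"
      then obtain u where "u \<in> \<U>" "max (q - e) ((1 + q) / 2) < u" "u < q"
        using strict_base_limit_of_univoque[OF q False, of "max (q - e) ((1 + q) / 2)"] assms
        by (auto simp: less_max_iff_disj)
      then show "\<exists>u\<in>\<U>. dist u q < e" by (intro bexI[of _ u]) (auto simp: dist_real_def)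
    qed
  qed
qed

section \<open>Stability\<close>

theorem proposition6p9:
  fixes q :: real
  assumes "q > 1"
  shows "(q \<in> closure \<U> \<longrightarrow> \<not> stable_below q \<and> \<not> stable_above q) \<and>
    (q \<in> \<V> - closure \<U> \<longrightarrow> stable_below q \<and> \<not> stable_above q) \<and>
    (q \<notin> \<V> \<longrightarrow> stable_base q)"
proof -
  have not_above: "\<not> stable_above q" if "q \<in> \<V>"
    using univoque_seqs_neqI[of q q] that assms by (auto simp: stable_above_def)
  have not_below: "\<not> stable_below q" if q: "q \<in> strict_bases"
  proof
    assume "stable_below q"
    then obtain s where s: "1 < s" "s < q" "univoque_seqs q = univoque_seqs s"
      by (auto simp: stable_below_def)
    obtain t where "t \<in> \<V>" "s < t" "t < q" using strict_base_limit_of_V[OF q s(1,2)] by blast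
    then show False using univoque_seqs_neqI[of s t q] s by simp
  qed
  have below: "stable_below q" if q: "q \<notin> strict_bases"
  proof -
    obtain l where l: "1 < l" "l < q" "\<And>t. l < t \<Longrightarrow> t < q \<Longrightarrow> univoque_seqs t = univoque_seqs q"
      using left_neighbourhood[OF assms q] by blast
    then obtain t where "l < t" "t < q" using dense by blast
    then show ?thesis using l by (auto simp: stable_below_def intro!: exI[of _ t])
  qed
  have above: "stable_above q" if q: "q \<notin> \<V>"
  proof -
    obtain r where r: "q < r" "\<And>s. q < s \<Longrightarrow> s < r \<Longrightarrow> univoque_seqs q = univoque_seqs s"
      using right_neighbourhood[OF assms] strict_bases_subset_V q by blast
    then obtain s where "q < s" "s < r" using dense by blast
    then show ?thesis using r by (auto simp: stable_above_def intro!: exI[of _ s])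
  qed
  show ?thesis
    using not_above not_below below above strict_bases_subset_V closure_univoque_bases_iff[OF assms]
    by (auto simp: stable_base_def)
qed

end
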